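(* Let $a,b$ be nonnegative integers and let $u\in\mathbb{C}$ with $\mathrm{Re}(1+\tfrac32u)>0$. Then \[ \mathrm{CT}\bigg[(1-x)^a(1-y)^a(1-z)^a\Big(1-\frac1x\Big)^b\Big(1-\frac1y\Big)^b\Big(1-\frac1z\Big)^b\Big(1-\frac xy\Big)^u\Big(1-\frac yz\Big)^u\Big(1-\frac zx\Big)^u\bigg] \] \[ =\cos\big(\tfrac12\pi u\big)\,\frac{\Gamma(1+\frac32u)}{\Gamma(1+\frac12u)^3}\prod_{i=0}^2\frac{(1+\frac12iu)_{a+b}}{(1+\frac12iu)_a(1+\frac12iu)_b}. \]
   Context: $\mathrm{CT}$ denotes the constant term (coefficient of $x^0y^0z^0$). $(c)_N=c(c+1)\cdots(c+N-1)$ is the Pochhammer symbol. The factors with exponent $u$ are expanded by the binomial series $(1-w)^u=\sum_{N\ge0}(-w)^N\binom uN$, $\binom uN=(-1)^N(-u)_N/N!$, in $w=x/y$, $w=y/z$, $w=z/x$ respectively. The constant term is the sum of all coefficients of terms in the fully expanded product whose monomial is $1$. Since $(x/y)(y/z)(z/x)=1$ this is an infinite numerical series; it converges absolutely for $\mathrm{Re}(1+\frac32u)>0$. *)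

theory Defs
  imports "HOL-Analysis.Analysis"
begin

text \<open>A Laurent monomial \<open>x\<^sup>i y\<^sup>j z\<^sup>k\<close> is represented by its exponent vector
  \<open>vector [i, j, k]\<close>, so products of monomials are sums of vectors and the monomial \<open>1\<close> is
  the zero vector.\<close>

type_synonym monomial = "int ^ 3"

text \<open>A list \<open>[(w\<^sub>0, c\<^sub>0), \<dots>]\<close> of this type stands for the formal product of
  the powers \<open>(1 - w\<^sub>k) powr c\<^sub>k\<close>, each of which is expanded by the binomial series
  \<open>(1 - w) powr c = (\<Sum>N. (- w) ^ N * (c gchoose N))\<close>. If \<open>c = of_nat m\<close> then
  \<open>c gchoose N\<close> vanishes for \<open>N > m\<close>, so that the expansion is the finite binomial theorem.
  Choosing one term, with index \<open>ns ! k\<close>, from each factor gives one term of the fully expanded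
  product; terms with the same monomial are not collected.\<close>

type_synonym binomial_product = "(monomial \<times> complex) list"

definition term_coeff :: "binomial_product \<Rightarrow> nat list \<Rightarrow> complex" where
  "term_coeff fs ns = (\<Prod>k<length fs. (- 1) ^ (ns ! k) * (snd (fs ! k) gchoose (ns ! k)))"

definition term_monomial :: "binomial_product \<Rightarrow> nat list \<Rightarrow> monomial" where
  "term_monomial fs ns = (\<Sum>k<length fs. int (ns ! k) *s fst (fs ! k))"

definition constant_terms :: "binomial_product \<Rightarrow> nat list set" where
  "constant_terms fs = {ns. length ns = length fs \<and> term_monomial fs ns = 0}"

text \<open>Since \<open>infsum\<close> is \<open>0\<close> on families that are not summable, \<open>CT\<close> is only meaningful
  under \<open>CT_abs_convergent\<close>.\<close>

definition CT_abs_convergent :: "binomial_product \<Rightarrow> bool" where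
  "CT_abs_convergent fs \<longleftrightarrow> (\<lambda>ns. norm (term_coeff fs ns)) summable_on constant_terms fs"

definition CT :: "binomial_product \<Rightarrow> complex" where
  "CT fs = infsum (term_coeff fs) (constant_terms fs)"

definition dyson_product :: "nat \<Rightarrow> nat \<Rightarrow> complex \<Rightarrow> binomial_product" where
  "dyson_product a b u =
    (let x = vector [1, 0, 0]; y = vector [0, 1, 0]; z = vector [0, 0, 1] in
     [(x, of_nat a), (y, of_nat a), (z, of_nat a),
      (- x, of_nat b), (- y, of_nat b), (- z, of_nat b),
      (x - y, u), (y - z, u), (z - x, u)])"

end

theory Submission imports Defs
begin

text \<open>For \<open>b = 0\<close> only the constant term of \<open>((1 - x) (1 - y) (1 - z))\<^sup>a\<close> contributes, because the other
  factors are homogeneous of degree 0, and the constant term is \<open>\<Sum>n. (-1)\<^sup>n (u gchoose n)\<^sup>3\<close>, a case of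
  Dixon's theorem.  That sum is embedded in the family
  \<open>\<^sub>3F\<^sub>2(v - u, -u, -u; v + 1, v + 1; 1)\<close> with \<open>v = 0, 2, 4, \<dots>\<close>, which satisfies a first-order
  recurrence in \<open>v\<close> and tends to 1; the resulting infinite product gives the Gamma and cosine factors.

  For \<open>N = a + b\<close> fixed, Aomoto's method lowers \<open>b\<close>.  Let \<open>W\<close> be the product of \<open>x\<^sup>-\<^sup>b (1 - x)\<^sup>N\<close>
  over the three variables, call the product of the powers with exponent \<open>u\<close> the kernel, and let \<open>A r\<close>
  be the constant term of \<open>W\<close> times the kernel times the \<open>r\<close>-th elementary symmetric polynomial in \<open>x, y, z\<close>.
  The constant term of \<open>x \<partial>/\<partial>x\<close> of \<open>(1 - x) g(y, z) W\<close> times the kernel vanishes.  Taking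
  \<open>g = 1, y + z, y z\<close> expresses \<open>A (r + 1)\<close> by \<open>A r\<close>, and up to sign \<open>A 0\<close> and \<open>A 3\<close> are the constant
  terms for \<open>(a, b)\<close> and \<open>(a + 1, b - 1)\<close>.\<close>

section \<open>Dixon's sum\<close>

text \<open>Well-poised because \<open>1 + (v - u) - (- u) = v + 1\<close>. With \<open>v\<close> a
  natural number the symbols in the denominator never vanish.\<close>

definition dixon_term :: "complex \<Rightarrow> nat \<Rightarrow> nat \<Rightarrow> complex" where
  "dixon_term u v n =
     pochhammer (of_nat v - u) n * pochhammer (- u) n ^ 2 /
     (fact n * pochhammer (of_nat v + 1) n ^ 2)"

lemma pochhammer_of_nat_plus_1_nz: "pochhammer (of_nat v + 1 :: complex) n \<noteq> 0"
proof -
  have "(of_nat v + 1 :: complex) \<noteq> - of_nat k" for k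
    by (metis add.commute add_eq_0_iff of_nat_Suc of_nat_add of_nat_eq_0_iff nat.distinct(1) add_Suc)
  then show ?thesis
    by (auto simp: pochhammer_eq_0_iff)
qed

lemma of_nat_plus_neq_0: "k > 0 \<Longrightarrow> (of_nat v + of_nat k :: complex) \<noteq> 0"
  by (metis add_is_0 less_numeral_extra(3) of_nat_add of_nat_eq_0_iff)

text \<open>The powers of \<open>n\<close> hidden in the five \<open>rGamma_series\<close> factors
  combine to the exponent \<open>(v - u) - 2 * u - 2 * (v + 1)\<close>. The factor
  \<open>Suc n\<close> on the left is there because \<open>rGamma_series z n\<close> pairs
  \<open>pochhammer z (Suc n)\<close> with \<open>fact n\<close>.\<close>

lemma dixon_term_asymptotic:
  assumes "n > 0"
  shows "dixon_term u v (Suc n) * of_nat (Suc n) =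
    rGamma_series (of_nat v - u) n * rGamma_series (- u) n ^ 2 / rGamma_series (of_nat v + 1) n ^ 2
      * of_nat n powr (- of_nat v - 2 - 3 * u)"
proof -
  define L :: complex where "L = of_real (ln (real n))"
  have pw: "of_nat n powr c = exp (c * L)" for c :: complex
    using assms by (simp add: powr_def L_def Ln_of_nat)
  have e: "exp ((of_nat v - u) * L) * exp (- u * L) ^ 2 =
      exp ((- of_nat v - 2 - 3 * u) * L) * exp ((of_nat v + 1) * L) ^ 2"
    by (simp add: exp_of_nat_mult[symmetric] exp_add[symmetric] algebra_simps del: exp_of_nat_mult)
  define X Y Z f :: complex where "X = pochhammer (of_nat v - u) (Suc n)" and "Y = pochhammer (- u) (Suc n)"
    and "Z = pochhammer (of_nat v + 1) (Suc n)" and "f = fact n"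
  define eX eY eZ E where "eX = exp ((of_nat v - u) * L)" and "eY = exp (- u * L)"
    and "eZ = exp ((of_nat v + 1) * L)" and "E = exp ((- of_nat v - 2 - 3 * u) * L)"
  have nz: "Z \<noteq> 0" "f \<noteq> 0" "eX \<noteq> 0" "eY \<noteq> 0" "eZ \<noteq> 0" "(of_nat (Suc n) :: complex) \<noteq> 0"
    by (simp_all add: Z_def f_def eX_def eY_def eZ_def pochhammer_of_nat_plus_1_nz del: of_nat_Suc)
  have e': "eX * eY ^ 2 = E * eZ ^ 2"
    using e by (simp add: eX_def eY_def eZ_def E_def)
  have "dixon_term u v (Suc n) * of_nat (Suc n) = X * Y ^ 2 / (f * Z ^ 2)"
    using nz by (simp add: dixon_term_def X_def Y_def Z_def f_def del: of_nat_Suc)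
  also have "\<dots> = (X / (f * eX)) * (Y / (f * eY)) ^ 2 / (Z / (f * eZ)) ^ 2 * (eX * eY ^ 2 / eZ ^ 2)"
    using nz by (simp add: field_simps power2_eq_square)
  also have "eX * eY ^ 2 / eZ ^ 2 = E"
    using nz by (simp add: e')
  finally show ?thesis
    unfolding rGamma_series_def pw
    by (simp add: X_def Y_def Z_def f_def eX_def eY_def eZ_def E_def L_def)
qed

text \<open>The quotient of \<open>rGamma_series\<close> values converges, as
  \<open>rGamma (v + 1)\<close> is nonzero, and is therefore bounded. Dropping
  \<open>n powr (- v)\<close>, which is at most 1, makes the exponent independent of
  \<open>v\<close>.\<close>

lemma dixon_term_bound:
  obtains C where "\<And>n. n > 0 \<Longrightarrow>
    norm (dixon_term u v (Suc n)) * real (Suc n) \<le> C * real n powr (- 2 - 3 * Re u)"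
proof -
  let ?E = "\<lambda>n. rGamma_series (of_nat v - u) n * rGamma_series (- u) n ^ 2 / rGamma_series (of_nat v + 1) n ^ 2"
  have nz: "rGamma (of_nat v + 1 :: complex) \<noteq> 0"
    by (simp add: rGamma_eq_zero_iff) (metis add.commute of_nat_Suc of_nat_in_nonpos_Ints_iff nat.distinct(1))
  have "?E \<longlonglongrightarrow> rGamma (of_nat v - u) * rGamma (- u) ^ 2 / rGamma (of_nat v + 1) ^ 2"
    using nz by (intro tendsto_intros) auto
  then have "Bseq ?E"
    using convergent_def Bseq_def convergent_imp_Bseq by blast
  then obtain C where C: "C > 0" "\<And>n. norm (?E n) \<le> C"
    by (auto simp: Bseq_def)
  show ?thesis
  proof
    fix n :: nat assume n: "n > 0"
    have "norm (dixon_term u v (Suc n)) * real (Suc n) = norm (dixon_term u v (Suc n) * of_nat (Suc n))"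
      by (simp only: norm_mult norm_of_nat)
    also have "\<dots> = norm (?E n) * real n powr (- real v - 2 - 3 * Re u)"
      using n by (simp only: dixon_term_asymptotic[OF n] norm_mult) (simp add: norm_powr_real_powr)
    also have "\<dots> \<le> C * real n powr (- 2 - 3 * Re u)"
      using C n by (intro mult_mono powr_mono) auto
    finally show "norm (dixon_term u v (Suc n)) * real (Suc n) \<le> C * real n powr (- 2 - 3 * Re u)" .
  qed
qed

lemma dixon_term_times_index_tendsto_0:
  assumes "Re u > - 2 / 3"
  shows "(\<lambda>n. of_nat n * dixon_term u v n) \<longlonglongrightarrow> 0"
proof -
  obtain C where C: "\<And>n. n > 0 \<Longrightarrow>
    norm (dixon_term u v (Suc n)) * real (Suc n) \<le> C * real n powr (- 2 - 3 * Re u)"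
    using dixon_term_bound[of u v] by blast
  have "(\<lambda>n. C * real n powr (- 2 - 3 * Re u)) \<longlonglongrightarrow> C * 0"
    using assms by (intro tendsto_intros tendsto_neg_powr filterlim_real_sequentially) auto
  then have lim: "(\<lambda>n. C * real n powr (- 2 - 3 * Re u)) \<longlonglongrightarrow> 0"
    by simp
  have "norm (of_nat (Suc n) * dixon_term u v (Suc n)) \<le> C * real n powr (- 2 - 3 * Re u)" if "n > 0" for n
    using C[OF that] by (simp only: norm_mult norm_of_nat mult.commute)
  then have "eventually (\<lambda>n. norm (of_nat (Suc n) * dixon_term u v (Suc n)) \<le> C * real n powr (- 2 - 3 * Re u)) sequentially"
    by (intro eventually_mono[OF eventually_gt_at_top[of 0]])
  then have "(\<lambda>n. of_nat (Suc n) * dixon_term u v (Suc n)) \<longlonglongrightarrow> 0"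
    using lim by (rule Lim_null_comparison)
  then show ?thesis
    by (rule LIMSEQ_imp_Suc)
qed

text \<open>The hypothesis says exactly that the exponent \<open>- 3 - 3 * Re u\<close> is below
  -1.\<close>

lemma summable_norm_dixon_term:
  assumes "Re u > - 2 / 3"
  shows "summable (\<lambda>n. norm (dixon_term u v n))"
proof -
  obtain C where C: "\<And>n. n > 0 \<Longrightarrow>
    norm (dixon_term u v (Suc n)) * real (Suc n) \<le> C * real n powr (- 2 - 3 * Re u)"
    using dixon_term_bound[of u v] by blast
  have bd: "norm (dixon_term u v (Suc n)) \<le> C * real n powr (- 3 - 3 * Re u)" if n: "n > 0" for n
  proof -
    have "norm (dixon_term u v (Suc n)) * real n \<le> norm (dixon_term u v (Suc n)) * real (Suc n)"
      by (intro mult_left_mono) auto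
    also have "\<dots> \<le> C * real n powr (- 2 - 3 * Re u)"
      by (rule C[OF n])
    also have "real n powr (- 2 - 3 * Re u) = real n powr (- 3 - 3 * Re u) * real n"
      using n powr_add[of "real n" "- 3 - 3 * Re u" 1] by (simp add: algebra_simps)
    finally show ?thesis using n by simp
  qed
  have "summable (\<lambda>n. C * real n powr (- 3 - 3 * Re u))"
    using assms by (intro summable_mult) (simp add: summable_real_powr_iff)
  then have "summable (\<lambda>n. norm (dixon_term u v (Suc n)))"
    by (rule summable_comparison_test_ev[rotated])
       (auto intro!: eventually_mono[OF eventually_gt_at_top[of 0]] bd)
  then show ?thesis
    using summable_Suc_iff[of "\<lambda>n. norm (dixon_term u v n)"] by blast
qed

section \<open>Recurrence of the sum in \<open>v\<close> by creative telescoping\<close>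

text \<open>Wilf--Zeilberger certificate for the shift \<open>v \<mapsto> v + 2\<close> of the well-poised series.\<close>

definition dixon_certificate :: "complex \<Rightarrow> nat \<Rightarrow> nat \<Rightarrow> complex" where
  "dixon_certificate u v n = (let w = of_nat v; k = of_nat n in
     (w + 1) ^ 2 * (w + 2) ^ 2 * pochhammer (w + 1 - u) n * pochhammer (- u) (Suc n) ^ 2 /
     (fact n * pochhammer (w + 1) (n + 2) ^ 2) *
     ((w - u) * (k + w + 2) * (k + 2 * w + u + 3) - (u + 1) * (1 + w + u) * (2 + w + u)))"

text \<open>The certificate at 0 equals the summand at 0, so no lower boundary term appears. In the
  induction step all quantities are multiples of one factor \<open>M\<close>, which leaves a
  polynomial identity in \<open>w\<close>, \<open>u\<close> and \<open>k\<close>.\<close>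

lemma dixon_telescope:
  fixes u :: complex and v :: nat
  defines "w \<equiv> of_nat v :: complex"
  shows "(\<Sum>n\<le>K. (1 + w - u) * (1 + w + u) * (2 + w + u) ^ 3 * dixon_term u (v + 2) n
            - (2 + w + 3 * u) * (w + 1) ^ 2 * (w + 2) ^ 2 * dixon_term u v n) =
         dixon_certificate u v K"
proof (induction K)
  case 0
  have "w + 1 \<noteq> 0" "w + 2 \<noteq> 0"
    using of_nat_plus_neq_0[of 1 v] of_nat_plus_neq_0[of 2 v] by (auto simp: w_def)
  then show ?case
    by (simp add: dixon_term_def dixon_certificate_def Let_def w_def[symmetric] numeral_2_eq_2 pochhammer_Suc
          divide_simps)
       (simp add: algebra_simps power2_eq_square power3_eq_cube)
next
  case (Suc K)
  define k :: complex where "k = of_nat K"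
  define X where "X = pochhammer (w + 1 - u) K"
  define Y where "Y = pochhammer (- u) (Suc K)"
  define Z where "Z = pochhammer (w + 1) (Suc K)"
  define f :: complex where "f = fact K"
  have nz: "w + 1 \<noteq> 0" "w + 2 \<noteq> 0" "w + k + 2 \<noteq> 0" "w + k + 3 \<noteq> 0" "k + 1 \<noteq> 0" "f \<noteq> 0" "Z \<noteq> 0"
    using of_nat_plus_neq_0[of 1 v] of_nat_plus_neq_0[of 2 v] of_nat_plus_neq_0[of "K + 2" v]
      of_nat_plus_neq_0[of "K + 3" v] of_nat_plus_neq_0[of 1 K] pochhammer_of_nat_plus_1_nz[of v "Suc K"]
    by (simp_all add: w_def k_def f_def Z_def add_ac)
  have e1: "pochhammer (w - u) (Suc K) = (w - u) * X"
    by (simp add: X_def pochhammer_rec algebra_simps)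
  \<comment> \<open>The coefficient \<open>1 + w - u\<close> of the recurrence completes the shifted
    Pochhammer symbol, so \<open>X\<close> can be factored out without dividing by
    \<open>1 + w - u\<close>.\<close>
  have e2: "(1 + w - u) * pochhammer (w + 2 - u) (Suc K) = X * (w + 1 - u + k) * (w + 2 - u + k)"
  proof -
    have "(1 + w - u) * pochhammer (w + 2 - u) (Suc K) = pochhammer (w + 1 - u) (Suc (Suc K))"
      by (subst (2) pochhammer_rec) (simp add: algebra_simps)
    also have "\<dots> = X * (w + 1 - u + k) * (w + 2 - u + k)"
      by (simp add: pochhammer_Suc X_def k_def algebra_simps)
    finally show ?thesis .
  qed
  have e3: "pochhammer (w + 3) (Suc K) = Z * (w + k + 2) * (w + k + 3) / ((w + 1) * (w + 2))"
  proof -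
    have "(w + 1) * ((w + 2) * pochhammer (w + 3) (Suc K)) = pochhammer (w + 1) (Suc (Suc (Suc K)))"
      by (subst (2) pochhammer_rec, subst (2) pochhammer_rec) (simp add: algebra_simps)
    also have "\<dots> = Z * (w + k + 2) * (w + k + 3)"
      by (simp add: pochhammer_Suc Z_def k_def algebra_simps)
    finally show ?thesis using nz by (simp add: nonzero_eq_divide_eq mult_ac)
  qed
  have t2: "(1 + w - u) * dixon_term u (v + 2) (Suc K) =
     X * (w + 1 - u + k) * (w + 2 - u + k) * Y ^ 2 /
     ((k + 1) * f * (Z * (w + k + 2) * (w + k + 3) / ((w + 1) * (w + 2))) ^ 2)"
  proof -
    have "(1 + w - u) * dixon_term u (v + 2) (Suc K) =
      ((1 + w - u) * pochhammer (w + 2 - u) (Suc K)) * Y ^ 2 / (fact (Suc K) * pochhammer (w + 3) (Suc K) ^ 2)"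
      by (simp add: dixon_term_def w_def Y_def add.assoc add.commute)
    then show ?thesis by (simp only: e2 e3) (simp add: f_def k_def add.commute)
  qed
  have t1: "dixon_term u v (Suc K) = (w - u) * X * Y ^ 2 / ((k + 1) * f * Z ^ 2)"
    unfolding dixon_term_def w_def[symmetric] e1 by (simp add: f_def k_def Y_def Z_def add.commute)
  have c1: "dixon_certificate u v K = (w + 1) ^ 2 * (w + 2) ^ 2 * X * Y ^ 2 / (f * (Z * (w + k + 2)) ^ 2) *
     ((w - u) * (k + w + 2) * (k + 2 * w + u + 3) - (u + 1) * (1 + w + u) * (2 + w + u))"
  proof -
    have "pochhammer (w + 1) (K + 2) = Z * (w + k + 2)"
      by (simp add: pochhammer_Suc Z_def k_def algebra_simps)
    then show ?thesis
      unfolding dixon_certificate_def Let_def w_def[symmetric] k_def[symmetric]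
      by (simp add: f_def X_def Y_def)
  qed
  have c2: "dixon_certificate u v (Suc K) = (w + 1) ^ 2 * (w + 2) ^ 2 * (X * (w + 1 - u + k)) * (Y * (k + 1 - u)) ^ 2
     / ((k + 1) * f * (Z * (w + k + 2) * (w + k + 3)) ^ 2) *
     ((w - u) * (k + w + 3) * (k + 2 * w + u + 4) - (u + 1) * (1 + w + u) * (2 + w + u))"
  proof -
    have "pochhammer (w + 1) (Suc K + 2) = Z * (w + k + 2) * (w + k + 3)"
      by (simp add: pochhammer_Suc Z_def k_def algebra_simps)
    moreover have "pochhammer (- u) (Suc (Suc K)) = Y * (k + 1 - u)"
      by (simp add: pochhammer_Suc[of _ "Suc K"] Y_def k_def algebra_simps)
    moreover have "pochhammer (w + 1 - u) (Suc K) = X * (w + 1 - u + k)"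
      by (simp add: pochhammer_Suc X_def k_def)
    ultimately show ?thesis
      unfolding dixon_certificate_def Let_def w_def[symmetric]
      by (simp add: f_def k_def add_ac)
  qed
  \<comment> \<open>The induction step after the factor \<open>M\<close> defined below has been
    taken out of both summands and both certificates.\<close>
  have key: "(1 + w + u) * (2 + w + u) ^ 3 * ((w + 1 - u + k) * (w + 2 - u + k) * (w + 1) ^ 2 * (w + 2) ^ 2)
      - (2 + w + 3 * u) * (w + 1) ^ 2 * (w + 2) ^ 2 * ((w - u) * (w + k + 2) ^ 2 * (w + k + 3) ^ 2) =
    (w + 1) ^ 2 * (w + 2) ^ 2 * (w + 1 - u + k) * (k + 1 - u) ^ 2 *
     ((w - u) * (k + w + 3) * (k + 2 * w + u + 4) - (u + 1) * (1 + w + u) * (2 + w + u))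
    - (w + 1) ^ 2 * (w + 2) ^ 2 * (k + 1) * (w + k + 3) ^ 2 *
     ((w - u) * (k + w + 2) * (k + 2 * w + u + 3) - (u + 1) * (1 + w + u) * (2 + w + u))"
    by algebra
  define M where "M = X * Y ^ 2 / ((k + 1) * f * (Z * (w + k + 2) * (w + k + 3)) ^ 2)"
  have M1: "X * Y ^ 2 / ((k + 1) * f * Z ^ 2) = M * ((w + k + 2) ^ 2 * (w + k + 3) ^ 2)"
    using nz(3,4) unfolding M_def power_mult_distrib by simp
  have M2: "X * Y ^ 2 / ((k + 1) * f * (Z * (w + k + 2) * (w + k + 3) / ((w + 1) * (w + 2))) ^ 2) =
      M * ((w + 1) ^ 2 * (w + 2) ^ 2)"
    unfolding M_def power_divide power_mult_distrib by simp
  have M3: "X * Y ^ 2 / (f * (Z * (w + k + 2)) ^ 2) = M * ((k + 1) * (w + k + 3) ^ 2)"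
    using nz(4,5) unfolding M_def power_mult_distrib by simp
  have t2': "(1 + w - u) * dixon_term u (v + 2) (Suc K) =
      M * ((w + 1 - u + k) * (w + 2 - u + k) * (w + 1) ^ 2 * (w + 2) ^ 2)"
  proof -
    have "(1 + w - u) * dixon_term u (v + 2) (Suc K) = (w + 1 - u + k) * (w + 2 - u + k) *
      (X * Y ^ 2 / ((k + 1) * f * (Z * (w + k + 2) * (w + k + 3) / ((w + 1) * (w + 2))) ^ 2))"
      unfolding t2 by (simp only: times_divide_eq_right mult_ac)
    then show ?thesis unfolding M2 by (simp only: mult_ac)
  qed
  have t1': "dixon_term u v (Suc K) = M * ((w - u) * (w + k + 2) ^ 2 * (w + k + 3) ^ 2)"
  proof -
    have "dixon_term u v (Suc K) = (w - u) * (X * Y ^ 2 / ((k + 1) * f * Z ^ 2))"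
      unfolding t1 by (simp only: times_divide_eq_right mult_ac)
    then show ?thesis unfolding M1 by (simp only: mult_ac)
  qed
  have c1': "dixon_certificate u v K = M * ((w + 1) ^ 2 * (w + 2) ^ 2 * (k + 1) * (w + k + 3) ^ 2 *
     ((w - u) * (k + w + 2) * (k + 2 * w + u + 3) - (u + 1) * (1 + w + u) * (2 + w + u)))"
  proof -
    have "dixon_certificate u v K = (w + 1) ^ 2 * (w + 2) ^ 2 * (X * Y ^ 2 / (f * (Z * (w + k + 2)) ^ 2)) *
     ((w - u) * (k + w + 2) * (k + 2 * w + u + 3) - (u + 1) * (1 + w + u) * (2 + w + u))"
      unfolding c1 by (simp only: times_divide_eq_right mult.assoc)
    then show ?thesis unfolding M3 by (simp only: mult_ac)
  qed
  have c2': "dixon_certificate u v (Suc K) = M * ((w + 1) ^ 2 * (w + 2) ^ 2 * (w + 1 - u + k) * (k + 1 - u) ^ 2 *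
     ((w - u) * (k + w + 3) * (k + 2 * w + u + 4) - (u + 1) * (1 + w + u) * (2 + w + u)))"
    unfolding c2 M_def power_mult_distrib[of Y] by (simp only: times_divide_eq_right times_divide_eq_left mult_ac)
  have "(1 + w - u) * (1 + w + u) * (2 + w + u) ^ 3 * dixon_term u (v + 2) (Suc K)
            - (2 + w + 3 * u) * (w + 1) ^ 2 * (w + 2) ^ 2 * dixon_term u v (Suc K)
     = (1 + w + u) * (2 + w + u) ^ 3 * ((1 + w - u) * dixon_term u (v + 2) (Suc K))
            - (2 + w + 3 * u) * (w + 1) ^ 2 * (w + 2) ^ 2 * dixon_term u v (Suc K)"
    by (simp add: mult_ac)
  also have "\<dots> = M * ((1 + w + u) * (2 + w + u) ^ 3 * ((w + 1 - u + k) * (w + 2 - u + k) * (w + 1) ^ 2 * (w + 2) ^ 2)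
      - (2 + w + 3 * u) * (w + 1) ^ 2 * (w + 2) ^ 2 * ((w - u) * (w + k + 2) ^ 2 * (w + k + 3) ^ 2))"
    unfolding t2' t1' by (simp only: right_diff_distrib mult_ac)
  also have "\<dots> = dixon_certificate u v (Suc K) - dixon_certificate u v K"
    unfolding key c1' c2' by (simp only: right_diff_distrib)
  finally show ?case
    by (simp add: Suc.IH del: add_2_eq_Suc')
qed


text \<open>The certificate is \<open>Suc n\<close> times the term of index \<open>Suc n\<close>
  times a convergent factor \<open>r\<close>. This form divides by \<open>w - u\<close>; for
  \<open>u = of_nat v\<close> the factor \<open>pochhammer (- u) (Suc n)\<close> makes the
  certificate eventually 0 instead.\<close>

lemma dixon_certificate_tendsto_0:
  assumes "Re u > - 2 / 3"
  shows "dixon_certificate u v \<longlonglongrightarrow> 0"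
proof (cases "u = of_nat v")
  case True
  have "dixon_certificate u v n = 0" if "n \<ge> v" for n
  proof -
    have "pochhammer (- of_nat v :: complex) (Suc n) = 0"
      using that by (intro pochhammer_of_nat_eq_0_lemma) auto
    then show ?thesis
      by (simp add: dixon_certificate_def True)
  qed
  then show ?thesis
    by (intro tendsto_eventually eventually_sequentiallyI)
next
  case False
  define w where "w = (of_nat v :: complex)"
  define r where "r = (\<lambda>n. let k = of_nat n in (w + 1) ^ 2 * (w + 2) ^ 2 *
    ((w - u) * ((k + w + 2) / (k + w + 2)) * ((k + 2 * w + u + 3) / (k + w + 2)) - (u + 1) * (1 + w + u) * (2 + w + u) / (k + w + 2) ^ 2)
    / (w - u))"
  have eq: "dixon_certificate u v n = of_nat (Suc n) * dixon_term u v (Suc n) * r n" for n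
  proof -
    define k :: complex where "k = of_nat n"
    have nz: "k + w + 2 \<noteq> 0" "k + 1 \<noteq> 0" "w - u \<noteq> 0"
      using of_nat_plus_neq_0[of "n + 2" v] of_nat_plus_neq_0[of 1 n] False
      by (simp_all add: w_def k_def add_ac)
    have e1: "pochhammer (w - u) (Suc n) = (w - u) * pochhammer (w + 1 - u) n"
      by (simp add: pochhammer_rec algebra_simps)
    have e2: "pochhammer (w + 1) (n + 2) = pochhammer (w + 1) (Suc n) * (k + w + 2)"
      by (simp add: pochhammer_Suc k_def algebra_simps)
    have e3: "fact (Suc n) = (k + 1) * fact n"
      by (simp add: k_def add_ac)
    define X Y Z f where "X = pochhammer (w + 1 - u) n" and "Y = pochhammer (- u) (Suc n)"
      and "Z = pochhammer (w + 1) (Suc n)" and "f = (fact n :: complex)"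
    have nz': "Z \<noteq> 0" "f \<noteq> 0"
      unfolding Z_def f_def w_def by (auto simp: pochhammer_of_nat_plus_1_nz)
    have "r n = (w + 1) ^ 2 * (w + 2) ^ 2 *
       ((w - u) * (k + w + 2) * (k + 2 * w + u + 3) - (u + 1) * (1 + w + u) * (2 + w + u)) / (k + w + 2) ^ 2 / (w - u)"
    proof -
      have "(w - u) * (k + 2 * w + u + 3) / (k + w + 2) - (u + 1) * (1 + w + u) * (2 + w + u) / (k + w + 2) ^ 2 =
        ((w - u) * (k + w + 2) * (k + 2 * w + u + 3) - (u + 1) * (1 + w + u) * (2 + w + u)) / (k + w + 2) ^ 2"
        using nz by (simp add: diff_divide_distrib power2_eq_square)
      then show ?thesis
        using nz by (simp add: r_def Let_def k_def[symmetric])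
    qed
    moreover have "of_nat (Suc n) * dixon_term u v (Suc n) = (w - u) * X * Y ^ 2 / (f * Z ^ 2)"
      using nz unfolding dixon_term_def w_def[symmetric] e1 e3 by (simp add: X_def Y_def Z_def f_def k_def add_ac)
    moreover have "dixon_certificate u v n = (w + 1) ^ 2 * (w + 2) ^ 2 * X * Y ^ 2 / (f * (Z * (k + w + 2)) ^ 2) *
       ((w - u) * (k + w + 2) * (k + 2 * w + u + 3) - (u + 1) * (1 + w + u) * (2 + w + u))"
      unfolding dixon_certificate_def Let_def w_def[symmetric] e2 by (simp add: X_def Y_def Z_def f_def k_def)
    ultimately show ?thesis
      using nz nz' by (simp add: power_mult_distrib)
  qed
  have inf: "filterlim (\<lambda>n. of_nat n + (w + 2)) at_infinity sequentially"
    by (rule tendsto_add_filterlim_at_infinity'[OF tendsto_of_nat tendsto_const])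
  have lim0: "(\<lambda>n. c / (of_nat n + (w + 2))) \<longlonglongrightarrow> 0" for c
    by (rule tendsto_divide_0[OF tendsto_const inf])
  have nz: "of_nat n + (w + 2) \<noteq> 0" for n
    using of_nat_plus_neq_0[of "n + 2" v] by (simp add: w_def add_ac)
  have lim1: "(\<lambda>n. (of_nat n + 2 * w + u + 3) / (of_nat n + (w + 2))) \<longlonglongrightarrow> 1 + 0"
  proof -
    have "(of_nat n + 2 * w + u + 3) / (of_nat n + (w + 2)) = 1 + (w + u + 1) / (of_nat n + (w + 2))" for n
      using nz[of n] by (simp add: field_simps)
    then show ?thesis
      by (simp only: tendsto_add[OF tendsto_const lim0])
  qed
  have "r \<longlonglongrightarrow> (w + 1) ^ 2 * (w + 2) ^ 2 * ((w - u) * 1 * (1 + 0) - (u + 1) * (1 + w + u) * (0 * 0)) / (w - u)"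
  proof -
    have "r = (\<lambda>n. (w + 1) ^ 2 * (w + 2) ^ 2 *
      ((w - u) * 1 * ((of_nat n + 2 * w + u + 3) / (of_nat n + (w + 2))) - (u + 1) * (1 + w + u) *
        ((1 / (of_nat n + (w + 2))) * ((2 + w + u) / (of_nat n + (w + 2))))) / (w - u))"
      using nz by (simp add: r_def Let_def fun_eq_iff add.assoc power2_eq_square)
    then show ?thesis
      using False by (simp only:) (intro tendsto_intros lim0 lim1, auto simp: w_def)
  qed
  from tendsto_mult[OF LIMSEQ_Suc[OF dixon_term_times_index_tendsto_0[OF assms, of v]] this]
  show ?thesis
    by (simp only: eq[abs_def] mult_zero_left)
qed

definition dixon_sum :: "complex \<Rightarrow> nat \<Rightarrow> complex" where
  "dixon_sum u v = (\<Sum>n. dixon_term u v n)"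

lemma dixon_sum_recurrence:
  fixes u :: complex and v :: nat
  assumes "Re u > - 2 / 3"
  defines "w \<equiv> of_nat v :: complex"
  shows "(1 + w - u) * (1 + w + u) * (2 + w + u) ^ 3 * dixon_sum u (v + 2) =
         (2 + w + 3 * u) * (w + 1) ^ 2 * (w + 2) ^ 2 * dixon_sum u v"
proof -
  define A B where "A = (1 + w - u) * (1 + w + u) * (2 + w + u) ^ 3"
    and "B = (2 + w + 3 * u) * (w + 1) ^ 2 * (w + 2) ^ 2"
  have sums: "dixon_term u v sums dixon_sum u v" for v
    unfolding dixon_sum_def
    by (rule summable_sums[OF summable_norm_cancel[OF summable_norm_dixon_term[OF assms(1)]]])
  have "(\<lambda>n. A * dixon_term u (v + 2) n - B * dixon_term u v n) sums
      (A * dixon_sum u (v + 2) - B * dixon_sum u v)"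
    by (intro sums_diff sums_mult sums)
  then have "(\<lambda>K. \<Sum>n\<le>K. A * dixon_term u (v + 2) n - B * dixon_term u v n) \<longlonglongrightarrow>
      A * dixon_sum u (v + 2) - B * dixon_sum u v"
    by (simp add: sums_def_le)
  moreover have "(\<Sum>n\<le>K. A * dixon_term u (v + 2) n - B * dixon_term u v n) = dixon_certificate u v K" for K
    unfolding A_def B_def w_def by (rule dixon_telescope)
  ultimately have "dixon_certificate u v \<longlonglongrightarrow> A * dixon_sum u (v + 2) - B * dixon_sum u v"
    by (simp only:)
  then have "A * dixon_sum u (v + 2) - B * dixon_sum u v = 0"
    using dixon_certificate_tendsto_0[OF assms(1), of v] by (rule LIMSEQ_unique)
  then show ?thesis
    by (simp add: A_def B_def)
qed

section \<open>The limit of large \<open>v\<close> and Dixon's closed form\<close>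

text \<open>Compared factor by factor: with \<open>c = 2 * m + j\<close>, the square
  \<open>norm (c - u) ^ 2\<close> is at most \<open>c ^ 2 + 4 / 3 * c + c / 2\<close>, which is
  below \<open>(c + 1) ^ 2\<close>. Dominates the only upper parameter that moves with
  \<open>v = 2 * m\<close>.\<close>

lemma norm_pochhammer_le:
  fixes u :: complex
  assumes "Re u > - 2 / 3" and "norm u ^ 2 \<le> real m"
  shows "norm (pochhammer (of_nat (2 * m) - u) k) \<le> pochhammer (real (2 * m) + 1) k"
proof -
  have "norm (of_nat (2 * m) - u + of_nat j) \<le> real (2 * m) + 1 + real j" for j
  proof (rule power2_le_imp_le)
    define c where "c = real (2 * m) + real j"
    have "norm (of_nat (2 * m) - u + of_nat j) ^ 2 = (c - Re u) ^ 2 + Im u ^ 2"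
      by (simp add: cmod_power2 c_def algebra_simps)
    also have "\<dots> = c ^ 2 - 2 * c * Re u + norm u ^ 2"
      unfolding cmod_power2 by (simp add: power2_eq_square algebra_simps)
    also have "\<dots> \<le> (c + 1) ^ 2"
    proof -
      have "c * (- Re u) \<le> c * (2 / 3)"
        using assms(1) by (intro mult_left_mono) (auto simp: c_def)
      moreover have "norm u ^ 2 \<le> c / 2"
        using assms(2) by (simp add: c_def)
      ultimately show ?thesis
        by (simp add: power2_eq_square algebra_simps c_def)
    qed
    finally show "norm (of_nat (2 * m) - u + of_nat j) ^ 2 \<le> (real (2 * m) + 1 + real j) ^ 2"
      by (simp add: c_def algebra_simps)
  qed auto
  then show ?thesis
    unfolding pochhammer_prod prod_norm[symmetric] by (intro prod_mono) auto
qed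

text \<open>Tannery's theorem: the term with \<open>k = 0\<close> is 1, and each later term is of
  order \<open>1 / m\<close>. The majorant combines a bound \<open>B\<close> on
  \<open>pochhammer (- u) k / fact k\<close>, \<open>norm_pochhammer_le\<close>, and the decay of
  \<open>fact k / pochhammer (2 * m + 1) k\<close> in \<open>k\<close>.\<close>

lemma dixon_sum_tendsto_1:
  fixes u :: complex
  assumes "Re u > - 2 / 3"
  shows "(\<lambda>m. dixon_sum u (2 * m)) \<longlonglongrightarrow> 1"
proof -
  \<comment> \<open>The cube of this quotient is \<open>dixon_term u 0 k\<close>, which tends to
    0.\<close>
  obtain B where B: "B > 0" "\<And>k. norm (pochhammer (- u) k / fact k) \<le> B"
  proof -
    have "(\<lambda>n. norm (dixon_term u 0 n)) \<longlonglongrightarrow> 0"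
      using summable_LIMSEQ_zero[OF summable_norm_dixon_term[OF assms]] .
    moreover have "norm (dixon_term u 0 n) = norm (pochhammer (- u) n / fact n) ^ 3" for n
      by (simp add: dixon_term_def pochhammer_fact[symmetric] norm_mult norm_divide norm_power
          power2_eq_square power3_eq_cube)
    ultimately have "(\<lambda>n. root 3 (norm (pochhammer (- u) n / fact n) ^ 3)) \<longlonglongrightarrow> root 3 0"
      by (intro tendsto_real_root) simp
    then have "Bseq (\<lambda>n. pochhammer (- u) n / fact n)"
      by (intro convergent_imp_Bseq) (auto simp: real_root_power_cancel tendsto_norm_zero_iff convergent_def)
    then show ?thesis
      using that by (auto simp: Bseq_def)
  qed
  have bound: "norm (dixon_term u (2 * m) k) \<le> B ^ 2 * (fact k / pochhammer (real (2 * m) + 1) k)"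
    if "m \<ge> nat \<lceil>norm u ^ 2\<rceil>" for m k
  proof -
    have pos: "pochhammer (real (2 * m) + 1) k > 0"
      by (intro pochhammer_pos) auto
    have eq: "norm (pochhammer (of_nat (2 * m) + 1 :: complex) k) = pochhammer (real (2 * m) + 1) k"
    proof -
      have "pochhammer (of_nat (2 * m) + 1 :: complex) k = of_real (pochhammer (real (2 * m) + 1) k)"
        by (simp add: pochhammer_of_real[symmetric])
      then show ?thesis
        using pos by (simp only: norm_of_real abs_of_pos)
    qed
    have "norm (dixon_term u (2 * m) k) =
        norm (pochhammer (- u) k / fact k) ^ 2 *
        (norm (pochhammer (of_nat (2 * m) - u) k) / pochhammer (real (2 * m) + 1) k) *
        (fact k / pochhammer (real (2 * m) + 1) k)"
      unfolding dixon_term_def norm_mult norm_divide norm_power eq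
      by (simp add: power2_eq_square mult_ac)
    also have "\<dots> \<le> B ^ 2 * 1 * (fact k / pochhammer (real (2 * m) + 1) k)"
      using B pos norm_pochhammer_le[OF assms, of m k] that
      by (intro mult_mono power_mono) (auto simp: nat_le_iff ceiling_le_iff)
    finally show ?thesis by simp
  qed
  have lim: "(\<lambda>m. dixon_term u (2 * m) k) \<longlonglongrightarrow> (if k = 0 then 1 else 0)" for k
  proof (cases k)
    case 0
    then show ?thesis by (simp add: dixon_term_def)
  next
    case (Suc j)
    have "norm (dixon_term u (2 * m) k) \<le> B ^ 2 * fact k * (1 / real (Suc m))"
      if m: "m \<ge> nat \<lceil>norm u ^ 2\<rceil>" for m
    proof -
      have "1 * (real m + 1) \<le> pochhammer (real (2 * m) + 1) j * (real (2 * m) + 1 + real j)"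
      proof (intro mult_mono)
        have "1 \<le> (\<Prod>i<j. real (2 * m) + 1 + real i)"
          by (intro prod_ge_1) auto
        then show "1 \<le> pochhammer (real (2 * m) + 1) j"
          by (simp add: pochhammer_prod atLeast0LessThan)
      qed (auto simp: pochhammer_nonneg)
      then have "1 / pochhammer (real (2 * m) + 1) k \<le> 1 / real (Suc m)"
        by (intro divide_left_mono mult_pos_pos pochhammer_pos) (auto simp: Suc pochhammer_Suc)
      then have "B ^ 2 * fact k * (1 / pochhammer (real (2 * m) + 1) k) \<le> B ^ 2 * fact k * (1 / real (Suc m))"
        by (intro mult_left_mono) auto
      with bound[OF m, of k] show ?thesis by simp
    qed
    then have "eventually (\<lambda>m. norm (dixon_term u (2 * m) k) \<le> B ^ 2 * fact k * (1 / real (Suc m))) sequentially"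
      by (intro eventually_sequentiallyI)
    moreover have "(\<lambda>m. B ^ 2 * fact k * (1 / real (Suc m))) \<longlonglongrightarrow> B ^ 2 * fact k * 0"
      using LIMSEQ_inverse_real_of_nat by (intro tendsto_intros) (simp add: inverse_eq_divide)
    ultimately show ?thesis
      using Suc by (auto intro: Lim_null_comparison)
  qed
  \<comment> \<open>For \<open>m \<ge> 1\<close> the symbol \<open>pochhammer (2 * m + 1) k\<close>
    is at least \<open>pochhammer 3 k = fact (k + 2) / 2\<close>, which gives a majorant free of
    \<open>m\<close>.\<close>
  have bound': "norm (dixon_term u (2 * m) k) \<le> B ^ 2 * 2 * inverse (real (Suc k) ^ 2)"
    if m: "m \<ge> nat \<lceil>norm u ^ 2\<rceil>" "m \<ge> 1" for m k
  proof -
    have "fact k * (real (Suc k) ^ 2) \<le> fact k * ((k + 1) * (k + 2))"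
      by (simp add: power2_eq_square algebra_simps)
    also have "\<dots> = fact (k + 2)"
      by (simp add: algebra_simps)
    also have "fact (k + 2) = 2 * pochhammer (3 :: real) k"
    proof -
      have "pochhammer (1 :: real) (2 + k) = pochhammer 1 2 * pochhammer (1 + 2) k"
        by (subst pochhammer_product') simp
      then show ?thesis
        by (simp add: pochhammer_fact[symmetric] numeral_2_eq_2 pochhammer_Suc add.commute mult_ac)
    qed
    also have "pochhammer (3 :: real) k \<le> pochhammer (real (2 * m) + 1) k"
      using m unfolding pochhammer_prod by (intro prod_mono) auto
    finally have "fact k / pochhammer (real (2 * m) + 1) k \<le> 2 * inverse (real (Suc k) ^ 2)"
      by (simp add: field_simps pochhammer_pos del: of_nat_Suc)
    then have "B ^ 2 * (fact k / pochhammer (real (2 * m) + 1) k) \<le> B ^ 2 * (2 * inverse (real (Suc k) ^ 2))"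
      by (intro mult_left_mono) auto
    with bound[OF m(1), of k] show ?thesis by (simp add: mult.assoc)
  qed
  have "(\<lambda>m. \<Sum>k. dixon_term u (2 * m) k) \<longlonglongrightarrow> (\<Sum>k. if k = 0 then 1 else 0)"
  proof (rule tannerys_theorem[THEN conjunct2, THEN conjunct2])
    show "\<forall>\<^sub>F (k, m) in at_top \<times>\<^sub>F sequentially.
        norm (dixon_term u (2 * m) k) \<le> B ^ 2 * 2 * inverse (real (Suc k) ^ 2)"
      unfolding eventually_prod_filter
    proof (intro exI conjI allI impI)
      show "eventually (\<lambda>_. True) at_top" by simp
      show "eventually (\<lambda>m. m \<ge> max 1 (nat \<lceil>norm u ^ 2\<rceil>)) sequentially"
        by (rule eventually_ge_at_top)
      show "case (k, m) of (k, m) \<Rightarrow> norm (dixon_term u (2 * m) k) \<le> B ^ 2 * 2 * inverse (real (Suc k) ^ 2)"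
        if "max 1 (nat \<lceil>norm u ^ 2\<rceil>) \<le> m" for k m
        unfolding prod.case using that by (intro bound') linarith+
    qed
    show "summable (\<lambda>k. B ^ 2 * 2 * inverse (real (Suc k) ^ 2))"
      by (intro summable_mult) (subst summable_Suc_iff, rule inverse_power_summable, simp)
  qed (use lim in auto)
  moreover have "(\<Sum>k. if k = 0 then 1 else 0 :: complex) = 1"
    using sums_single[of 0 "\<lambda>_. 1 :: complex"] by (auto simp: sums_iff)
  ultimately show ?thesis
    by (simp add: dixon_sum_def)
qed

lemma dixon_identity:
  fixes u :: complex
  assumes "Re u > - 2 / 3"
  shows "dixon_sum u 0 = cos (1 / 2 * of_real pi * u) * (Gamma (1 + 3 / 2 * u) / Gamma (1 + 1 / 2 * u) ^ 3)"
proof -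
  \<comment> \<open>Product of the recurrence quotients for \<open>v = 0, 2, ..., 2 * M - 2\<close>.
    Halving the five linear factors on each side of the recurrence turns them into Pochhammer
    factors, whence the constant 32 below.\<close>
  define P :: "nat \<Rightarrow> complex" where "P = (\<lambda>M. pochhammer (1 / 2 - u / 2) M * pochhammer (1 / 2 + u / 2) M * pochhammer (1 + u / 2) M ^ 3 /
     (pochhammer (1 + 3 / 2 * u) M * pochhammer (1 / 2) M ^ 2 * pochhammer 1 M ^ 2))"
  have nz: "1 + 3 / 2 * u + of_nat k \<noteq> 0" "1 / 2 + of_nat k \<noteq> (0 :: complex)" "1 + of_nat k \<noteq> (0 :: complex)" for k
    using assms by (auto simp: complex_eq_iff)
  have D: "dixon_sum u 0 = P M * dixon_sum u (2 * M)" for M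
  proof (induction M)
    case 0
    then show ?case by (simp add: P_def)
  next
    case (Suc M)
    define k :: complex where "k = of_nat M"
    have nz': "1 + 3 / 2 * u + k \<noteq> 0" "1 / 2 + k \<noteq> 0" "1 + k \<noteq> 0"
      using nz[of M] by (auto simp: k_def)
    define A B where "A = (1 / 2 - u / 2 + k) * (1 / 2 + u / 2 + k) * (1 + u / 2 + k) ^ 3"
      and "B = (1 + 3 / 2 * u + k) * (1 / 2 + k) ^ 2 * (1 + k) ^ 2"
    have B: "B \<noteq> 0" using nz' by (simp add: B_def)
    have "32 * (A * dixon_sum u (2 * M + 2)) = 32 * (B * dixon_sum u (2 * M))"
    proof -
      have "32 * A = (1 + 2 * k - u) * (1 + 2 * k + u) * (2 + 2 * k + u) ^ 3"
      proof -
        have "1 + 2 * k - u = 2 * (1 / 2 - u / 2 + k)" "1 + 2 * k + u = 2 * (1 / 2 + u / 2 + k)"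
          "2 + 2 * k + u = 2 * (1 + u / 2 + k)" by simp_all
        moreover have "32 * (a * b * c ^ 3) = 2 * a * (2 * b) * (2 * c) ^ 3" for a b c :: complex
          by (simp add: power_mult_distrib)
        ultimately show ?thesis by (simp only: A_def)
      qed
      moreover have "32 * B = (2 + 2 * k + 3 * u) * (2 * k + 1) ^ 2 * (2 * k + 2) ^ 2"
      proof -
        have "2 + 2 * k + 3 * u = 2 * (1 + 3 / 2 * u + k)" "2 * k + 1 = 2 * (1 / 2 + k)"
          "2 * k + 2 = 2 * (1 + k)" by simp_all
        moreover have "32 * (a * b ^ 2 * c ^ 2) = 2 * a * (2 * b) ^ 2 * (2 * c) ^ 2" for a b c :: complex
          by (simp add: power_mult_distrib)
        ultimately show ?thesis by (simp only: B_def)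
      qed
      ultimately show ?thesis
        using dixon_sum_recurrence[OF assms, of "2 * M"] by (simp add: k_def mult.assoc[symmetric])
    qed
    \<comment> \<open>Only \<open>B\<close> is divided by: \<open>A\<close> vanishes when
      \<open>u = 2 * k + 1\<close>.\<close>
    then have "dixon_sum u (2 * M) = A / B * dixon_sum u (2 * M + 2)"
      using B by (simp add: field_simps)
    moreover have "P (Suc M) = P M * (A / B)"
      unfolding P_def A_def B_def pochhammer_Suc k_def power_mult_distrib times_divide_times_eq
      by (simp only: mult_ac)
    ultimately show ?case
      using Suc.IH by simp
  qed
  have PG: "P (Suc n) = rGamma_series (1 / 2 - u / 2) n * rGamma_series (1 / 2 + u / 2) n * rGamma_series (1 + u / 2) n ^ 3 /
      (rGamma_series (1 + 3 / 2 * u) n * rGamma_series (1 / 2) n ^ 2 * rGamma_series 1 n ^ 2)" for n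
  proof -
    define L :: complex where "L = of_real (ln (of_nat n))"
    define f :: complex where "f = fact n"
    \<comment> \<open>The parameters above and below the fraction have the same sum
      \<open>4 + 3 / 2 * u\<close>, so the powers of \<open>n\<close> cancel and \<open>P\<close>
      has a finite limit.\<close>
    have e: "exp ((1 / 2 - u / 2) * L) * exp ((1 / 2 + u / 2) * L) * exp ((1 + u / 2) * L) ^ 3 =
       exp ((1 + 3 / 2 * u) * L) * exp (1 / 2 * L) ^ 2 * exp (1 * L) ^ 2"
      by (simp add: power2_eq_square power3_eq_cube exp_add[symmetric] algebra_simps)
    have "rGamma_series z n = pochhammer z (Suc n) / (f * exp (z * L))" for z
      by (simp add: rGamma_series_def f_def L_def)
    then have "rGamma_series (1 / 2 - u / 2) n * rGamma_series (1 / 2 + u / 2) n * rGamma_series (1 + u / 2) n ^ 3 /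
      (rGamma_series (1 + 3 / 2 * u) n * rGamma_series (1 / 2) n ^ 2 * rGamma_series 1 n ^ 2) =
      P (Suc n) * ((f ^ 5 * (exp ((1 + 3 / 2 * u) * L) * exp (1 / 2 * L) ^ 2 * exp (1 * L) ^ 2)) /
        (f ^ 5 * (exp ((1 / 2 - u / 2) * L) * exp ((1 / 2 + u / 2) * L) * exp ((1 + u / 2) * L) ^ 3)))"
      by (simp only: P_def power_divide power_mult_distrib) (simp add: eval_nat_numeral mult_ac)
    also have "\<dots> = P (Suc n)"
      unfolding e by (simp add: f_def)
    finally show ?thesis ..
  qed
  have rnz: "rGamma (1 + 3 / 2 * u) \<noteq> 0"
  proof
    assume "rGamma (1 + 3 / 2 * u) = 0"
    then obtain n where "1 + 3 / 2 * u = - of_nat n"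
      unfolding rGamma_eq_zero_iff by (elim nonpos_Ints_cases')
    then show False using nz(1)[of n] by simp
  qed
  have "(\<lambda>n. P (Suc n)) \<longlonglongrightarrow> rGamma (1 / 2 - u / 2) * rGamma (1 / 2 + u / 2) * rGamma (1 + u / 2) ^ 3 /
      (rGamma (1 + 3 / 2 * u) * rGamma (1 / 2) ^ 2 * rGamma 1 ^ 2)"
    unfolding PG using rnz by (intro tendsto_intros) (auto simp: rGamma_eq_zero_iff)
  from tendsto_mult[OF this LIMSEQ_Suc[OF dixon_sum_tendsto_1[OF assms]]]
  have "dixon_sum u 0 = rGamma (1 / 2 - u / 2) * rGamma (1 / 2 + u / 2) * rGamma (1 + u / 2) ^ 3 /
      (rGamma (1 + 3 / 2 * u) * rGamma (1 / 2) ^ 2 * rGamma 1 ^ 2)"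
    by (simp only: D[symmetric] LIMSEQ_const_iff mult_1_right)
  \<comment> \<open>The reflection formula at \<open>1 / 2 + u / 2\<close> yields the cosine; its
    \<open>1 / pi\<close> cancels against \<open>rGamma (1 / 2) ^ 2\<close>.\<close>
  also have "rGamma (1 / 2 - u / 2) * rGamma (1 / 2 + u / 2) = cos (1 / 2 * of_real pi * u) / of_real pi"
    using rGamma_reflection_complex[of "1 / 2 + u / 2"] sin_add[of "of_real pi / 2" "of_real pi * u / 2"]
    by (simp add: algebra_simps)
  also have "rGamma (1 / 2 :: complex) ^ 2 = 1 / of_real pi"
    by (simp add: rGamma_inverse_Gamma Gamma_one_half_complex power_divide inverse_eq_divide
        of_real_power[symmetric] del: of_real_power)
  finally show ?thesis
    by (simp add: rGamma_inverse_Gamma field_simps)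
qed

section \<open>The pairing of Laurent polynomials with the kernel\<close>

text \<open>The coefficient of \<open>w ^ n\<close> in the binomial series of
  \<open>(1 - w) powr u\<close>.\<close>

definition binom_coeff :: "complex \<Rightarrow> nat \<Rightarrow> complex" where
  "binom_coeff u n = (- 1) ^ n * (u gchoose n)"

lemma binom_coeff_pochhammer: "binom_coeff u n = pochhammer (- u) n / fact n"
  by (simp add: binom_coeff_def gbinomial_pochhammer mult.assoc[symmetric] power_add[symmetric])

lemma binom_coeff_Suc: "of_nat (Suc n) * binom_coeff u (Suc n) = (of_nat n - u) * binom_coeff u n"
proof -
  have "binom_coeff u (Suc n) = pochhammer (- u) n * (of_nat n - u) / (of_nat (Suc n) * fact n)"
    by (simp add: binom_coeff_pochhammer pochhammer_Suc add.commute)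
  then show ?thesis
    unfolding binom_coeff_pochhammer[of u n] by (simp del: of_nat_Suc)
qed

lemma binom_coeff_power3: "binom_coeff u n ^ 3 = dixon_term u 0 n"
  by (simp add: binom_coeff_pochhammer dixon_term_def pochhammer_fact[symmetric]
      power2_eq_square power3_eq_cube mult_ac)

lemma norm_binom_coeff_power3: "norm (binom_coeff u n) ^ 3 = norm (dixon_term u 0 n)"
  by (simp add: binom_coeff_power3[symmetric] norm_power)

text \<open>Separates the three kernel indices, so that a triple product is controlled by the
  summable cubes of \<open>binom_coeff\<close>.\<close>

lemma prod3_le_sum_power3:
  fixes x y z :: real
  assumes "x \<ge> 0" "y \<ge> 0" "z \<ge> 0"
  shows "x * y * z \<le> x ^ 3 + y ^ 3 + z ^ 3"
proof -
  define t where "t = max x (max y z)"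
  have "x * y * z \<le> t * t * t"
    using assms by (intro mult_mono) (auto simp: t_def)
  also have "\<dots> = t ^ 3" by (simp add: power3_eq_cube)
  also have "\<dots> \<le> x ^ 3 + y ^ 3 + z ^ 3"
    using assms by (auto simp: t_def max_def)
  finally show ?thesis .
qed

text \<open>The indices \<open>l, m, n\<close> belong to \<open>x/y, y/z, z/x\<close>. The kernel
  term has exponents \<open>l - n, m - l, n - m\<close>, and \<open>H\<close> is evaluated at their
  negatives.\<close>

definition triple_term :: "complex \<Rightarrow> (int \<Rightarrow> int \<Rightarrow> int \<Rightarrow> complex) \<Rightarrow> nat \<times> nat \<times> nat \<Rightarrow> complex" where
  "triple_term u H = (\<lambda>(l, m, n). H (int n - int l) (int l - int m) (int m - int n) *
     (binom_coeff u l * binom_coeff u m * binom_coeff u n))"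

text \<open>If \<open>H p q r\<close> is the coefficient of \<open>x\<^sup>p y\<^sup>q z\<^sup>r\<close> in a Laurent polynomial \<open>h\<close>, then
  \<open>ct_pairing u H\<close> is the constant term of \<open>h (1 - x/y)\<^sup>u (1 - y/z)\<^sup>u (1 - z/x)\<^sup>u\<close>.\<close>

definition ct_pairing :: "complex \<Rightarrow> (int \<Rightarrow> int \<Rightarrow> int \<Rightarrow> complex) \<Rightarrow> complex" where
  "ct_pairing u H = infsum (triple_term u H) UNIV"

definition finite_support :: "(int \<Rightarrow> int \<Rightarrow> int \<Rightarrow> complex) \<Rightarrow> bool" where
  "finite_support H \<longleftrightarrow> finite {(p, q, r). H p q r \<noteq> 0}"

lemma finite_support_subset:
  assumes "finite A" "\<And>p q r. H p q r \<noteq> 0 \<Longrightarrow> (p, q, r) \<in> A"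
  shows "finite_support H"
  unfolding finite_support_def by (rule finite_subset[OF _ assms(1)]) (use assms(2) in auto)

lemma finite_support_add:
  assumes "finite_support G" "finite_support H"
  shows "finite_support (\<lambda>p q r. G p q r + H p q r)"
  by (rule finite_support_subset[OF finite_UnI[OF assms[unfolded finite_support_def]]]) auto

lemma finite_support_mult:
  assumes "finite_support H"
  shows "finite_support (\<lambda>p q r. c p q r * H p q r)"
  by (rule finite_support_subset[OF assms[unfolded finite_support_def]]) auto

lemma finite_support_prod:
  assumes "finite {p. \<alpha> p \<noteq> 0}" "finite {p. \<beta> p \<noteq> 0}" "finite {p. \<gamma> p \<noteq> 0}"
  shows "finite_support (\<lambda>p q r. \<alpha> p * \<beta> q * \<gamma> r)"
  by (rule finite_support_subset[OF finite_cartesian_product[OF assms(1) finite_cartesian_product[OF assms(2,3)]]])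
     auto

text \<open>On a fibre of the exponent map any one of \<open>l, m, n\<close> determines the other
  two, so \<open>prod3_le_sum_power3\<close> bounds the fibre by three copies of the cube series.
  Finite support leaves finitely many fibres.\<close>

lemma summable_on_norm_triple_term:
  assumes u: "Re u > - 2 / 3" and H: "finite_support H"
  shows "(\<lambda>x. norm (triple_term u H x)) summable_on UNIV"
proof -
  define d :: "nat \<times> nat \<times> nat \<Rightarrow> int \<times> int \<times> int"
    where "d = (\<lambda>(l, m, n). (int n - int l, int l - int m, int m - int n))"
  define S where "S = {(p, q, r). H p q r \<noteq> 0}"
  define b where "b = (\<lambda>n. norm (binom_coeff u n))"
  have "(\<lambda>n. b n ^ 3) summable_on UNIV"
    using summable_norm_dixon_term[OF u, of 0]
    by (intro summable_nonneg_imp_summable_on) (auto simp: norm_binom_coeff_power3 b_def)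
  then have cube: "(\<lambda>x. b (f x) ^ 3) summable_on A"
    if "inj_on f A" for f :: "nat \<times> nat \<times> nat \<Rightarrow> nat" and A
    using summable_on_reindex[OF that, of "\<lambda>n. b n ^ 3"] summable_on_subset_banach[of "\<lambda>n. b n ^ 3" UNIV "f ` A"]
    by (simp add: o_def)
  have fibre: "(\<lambda>x. norm (triple_term u H x)) summable_on (d -` {s})" for s
  proof -
    have inj: "inj_on fst (d -` {s})" "inj_on (fst \<circ> snd) (d -` {s})" "inj_on (snd \<circ> snd) (d -` {s})"
      by (auto simp: inj_on_def d_def)
    have "(\<lambda>x. norm (case s of (p, q, r) \<Rightarrow> H p q r) * (b (fst x) ^ 3 + b ((fst \<circ> snd) x) ^ 3 + b ((snd \<circ> snd) x) ^ 3))
        summable_on (d -` {s})"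
      by (intro summable_on_cmult_right summable_on_add cube inj)
    then show ?thesis
    proof (rule summable_on_comparison_test)
      fix x assume x: "x \<in> d -` {s}"
      obtain l m n where lmn: "x = (l, m, n)" by (cases x)
      have "norm (triple_term u H x) = norm (case s of (p, q, r) \<Rightarrow> H p q r) * (b l * b m * b n)"
        using x by (auto simp: lmn d_def triple_term_def norm_mult b_def)
      also have "\<dots> \<le> norm (case s of (p, q, r) \<Rightarrow> H p q r) * (b l ^ 3 + b m ^ 3 + b n ^ 3)"
        by (intro mult_left_mono prod3_le_sum_power3) (auto simp: b_def)
      finally show "norm (triple_term u H x) \<le> norm (case s of (p, q, r) \<Rightarrow> H p q r) *
          (b (fst x) ^ 3 + b ((fst \<circ> snd) x) ^ 3 + b ((snd \<circ> snd) x) ^ 3)"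
        by (simp add: lmn)
    qed auto
  qed
  have "(\<lambda>x. norm (triple_term u H x)) summable_on (\<Union>s\<in>S'. d -` {s})" if "finite S'" for S'
    using that by induction (auto intro: summable_on_union fibre)
  then have "(\<lambda>x. norm (triple_term u H x)) summable_on (\<Union>s\<in>S. d -` {s})"
    using H by (auto simp: S_def finite_support_def)
  then show ?thesis
    by (rule summable_on_cong_neutral[THEN iffD1, rotated -1]) (auto simp: S_def d_def triple_term_def)
qed

lemma summable_on_triple_term:
  assumes "Re u > - 2 / 3" "finite_support H"
  shows "triple_term u H summable_on UNIV"
  using summable_on_norm_triple_term[OF assms] by (rule abs_summable_summable)

lemma ct_pairing_add:
  assumes "Re u > - 2 / 3" "finite_support G" "finite_support H"
  shows "ct_pairing u (\<lambda>p q r. G p q r + H p q r) = ct_pairing u G + ct_pairing u H"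
proof -
  have "triple_term u (\<lambda>p q r. G p q r + H p q r) = (\<lambda>x. triple_term u G x + triple_term u H x)"
    by (auto simp: triple_term_def algebra_simps)
  then show ?thesis
    unfolding ct_pairing_def by (simp only:) (intro infsum_add summable_on_triple_term assms)
qed

lemma ct_pairing_cmult: "ct_pairing u (\<lambda>p q r. c * H p q r) = c * ct_pairing u H"
proof -
  have "triple_term u (\<lambda>p q r. c * H p q r) = (\<lambda>x. c * triple_term u H x)"
    by (auto simp: triple_term_def algebra_simps)
  then show ?thesis
    unfolding ct_pairing_def by (simp only: infsum_cmult_right')
qed

text \<open>The kernel is invariant under the cyclic substitution of \<open>x, y, z\<close>.\<close>

lemma ct_pairing_rotate: "ct_pairing u (\<lambda>p q r. H q r p) = ct_pairing u H"
  unfolding ct_pairing_def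
  by (rule infsum_reindex_bij_witness[where i = "\<lambda>(l, m, n). (n, l, m)" and j = "\<lambda>(l, m, n). (m, n, l)"])
     (auto simp: triple_term_def)

section \<open>Exhaustion by cubes and summation by parts\<close>

lemma sum_triple_term_tendsto:
  assumes "Re u > - 2 / 3" "finite_support H"
  shows "(\<lambda>K. sum (triple_term u H) ({..K} \<times> {..K} \<times> {..K})) \<longlonglongrightarrow> ct_pairing u H"
proof -
  have "filterlim (\<lambda>K::nat. {..K} \<times> {..K} \<times> {..K}) (finite_subsets_at_top UNIV) sequentially"
    unfolding filterlim_finite_subsets_at_top
  proof (intro allI impI)
    fix X :: "(nat \<times> nat \<times> nat) set" assume X: "finite X \<and> X \<subseteq> UNIV"
    define N where "N = (\<Sum>(l, m, n)\<in>X. l + m + n)"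
    have N: "l + m + n \<le> N" if "(l, m, n) \<in> X" for l m n
      unfolding N_def using X that member_le_sum[of "(l, m, n)" X "\<lambda>(l, m, n). l + m + n"] by auto
    then have "X \<subseteq> {..K} \<times> {..K} \<times> {..K}" if "K \<ge> N" for K
      using that by (fastforce dest: N)
    then show "\<forall>\<^sub>F K in sequentially. finite ({..K} \<times> {..K} \<times> {..K}) \<and>
        X \<subseteq> {..K} \<times> {..K} \<times> {..K} \<and> {..K} \<times> {..K} \<times> {..K} \<subseteq> UNIV"
      by (intro eventually_sequentiallyI[of N]) auto
  qed
  from filterlim_compose[OF infsum_tendsto[OF summable_on_triple_term[OF assms]] this]
  show ?thesis
    by (simp add: ct_pairing_def)
qed

text \<open>In the boundary terms every index stays within a bounded distance \<open>j\<close> of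
  \<open>K\<close>; replacing \<open>K + 1\<close> by the shifted index costs at most
  \<open>\<bar>j\<bar> + 1\<close>.\<close>

lemma binom_coeff_cube_tendsto_0:
  assumes "Re u > - 2 / 3"
  shows "(\<lambda>K. (real K + 1) * norm (binom_coeff u (nat (int K + j))) ^ 3) \<longlonglongrightarrow> 0"
proof -
  define e where "e = (\<lambda>n. norm (binom_coeff u n) ^ 3)"
  have lim: "filterlim (\<lambda>K. nat (int K + j)) sequentially sequentially"
    unfolding filterlim_at_top
  proof
    fix Z :: nat
    show "\<forall>\<^sub>F K in sequentially. Z \<le> nat (int K + j)"
      by (intro eventually_sequentiallyI[of "nat (int Z + \<bar>j\<bar>)"]) auto
  qed
  have 1: "(\<lambda>n. real n * e n) \<longlonglongrightarrow> 0"
    using tendsto_norm_zero[OF dixon_term_times_index_tendsto_0[OF assms, of 0]]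
    by (simp add: e_def norm_binom_coeff_power3 norm_mult)
  have 2: "e \<longlonglongrightarrow> 0"
    using summable_LIMSEQ_zero[OF summable_norm_dixon_term[OF assms, of 0]]
    by (simp add: e_def[abs_def] norm_binom_coeff_power3)
  have "(\<lambda>n. real n * e n + (real_of_int \<bar>j\<bar> + 1) * e n) \<longlonglongrightarrow> 0 + (real_of_int \<bar>j\<bar> + 1) * 0"
    by (intro tendsto_intros 1 2)
  from filterlim_compose[OF this lim]
  have "(\<lambda>K. real (nat (int K + j)) * e (nat (int K + j)) + (real_of_int \<bar>j\<bar> + 1) * e (nat (int K + j))) \<longlonglongrightarrow> 0"
    by simp
  then show ?thesis
  proof (rule Lim_null_comparison[rotated])
    show "\<forall>\<^sub>F K in sequentially. norm ((real K + 1) * norm (binom_coeff u (nat (int K + j))) ^ 3)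
       \<le> real (nat (int K + j)) * e (nat (int K + j)) + (real_of_int \<bar>j\<bar> + 1) * e (nat (int K + j))"
    proof (intro always_eventually allI)
      fix K
      have "(real K + 1) * e (nat (int K + j)) \<le> (real (nat (int K + j)) + (real_of_int \<bar>j\<bar> + 1)) * e (nat (int K + j))"
        by (intro mult_right_mono) (auto simp: e_def)
      then show "norm ((real K + 1) * norm (binom_coeff u (nat (int K + j))) ^ 3)
       \<le> real (nat (int K + j)) * e (nat (int K + j)) + (real_of_int \<bar>j\<bar> + 1) * e (nat (int K + j))"
        by (simp add: e_def algebra_simps)
    qed
  qed
qed

text \<open>A nonzero summand is determined by its exponents \<open>(p, q, r)\<close> in the support
  of \<open>Q\<close>, through \<open>m = K - q\<close> and \<open>n = K + p\<close>. Hence the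
  number of summands is bounded in \<open>K\<close>, and each tends to 0.\<close>

lemma boundary_tendsto_0:
  assumes u: "Re u > - 2 / 3" and Q: "finite_support Q"
  shows "(\<lambda>K. \<Sum>(m, n)\<in>{..K} \<times> {..K}. of_nat (Suc K) * binom_coeff u (Suc K) * binom_coeff u m * binom_coeff u n *
     Q (int n - int K) (int K - int m) (int m - int n)) \<longlonglongrightarrow> 0"
proof -
  define b where "b = (\<lambda>n. norm (binom_coeff u n))"
  define S where "S = {(p, q, r). Q p q r \<noteq> 0}"
  define g where "g = (\<lambda>K (p, q, r). norm (Q p q r) *
     ((real K + 1) * b (nat (int K + 1)) ^ 3 + (real K + 1) * b (nat (int K + (- q))) ^ 3 + (real K + 1) * b (nat (int K + p)) ^ 3))"
  have S: "finite S"
    using Q by (simp add: S_def finite_support_def)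
  have "(\<lambda>K. g K s) \<longlonglongrightarrow> 0" for s
  proof -
    obtain p q r where s: "s = (p, q, r)" by (cases s)
    have "(\<lambda>K. g K s) \<longlonglongrightarrow> norm (Q p q r) * (0 + 0 + 0)"
      unfolding g_def s prod.case b_def by (intro tendsto_intros binom_coeff_cube_tendsto_0 u)
    then show ?thesis by simp
  qed
  then have "(\<lambda>K. \<Sum>s\<in>S. g K s) \<longlonglongrightarrow> (\<Sum>s\<in>S. 0)"
    by (intro tendsto_sum)
  then have lim: "(\<lambda>K. \<Sum>s\<in>S. g K s) \<longlonglongrightarrow> 0" by simp
  show ?thesis
  proof (rule Lim_null_comparison[OF always_eventually[OF allI] lim])
    fix K
    define f where "f = (\<lambda>(m, n). of_nat (Suc K) * binom_coeff u (Suc K) * binom_coeff u m * binom_coeff u n *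
     Q (int n - int K) (int K - int m) (int m - int n))"
    define A where "A = {x \<in> {..K} \<times> {..K}. f x \<noteq> 0}"
    have "norm (\<Sum>x\<in>{..K} \<times> {..K}. f x) = norm (\<Sum>x\<in>A. f x)"
      by (intro arg_cong[of _ _ norm] sum.mono_neutral_right) (auto simp: A_def)
    also have "\<dots> \<le> (\<Sum>x\<in>A. norm (f x))"
      by (rule norm_sum)
    also have "\<dots> \<le> (\<Sum>s\<in>S. g K s)"
    proof (rule sum_le_included[where i = "\<lambda>(p, q, r). (nat (int K + - q), nat (int K + p))"])
      show "\<forall>s\<in>S. 0 \<le> g K s"
        by (auto simp: g_def b_def)
      show "\<forall>x\<in>A. \<exists>s\<in>S. (case s of (p, q, r) \<Rightarrow> (nat (int K + - q), nat (int K + p))) = x \<and> norm (f x) \<le> g K s"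
      proof
        fix x assume x: "x \<in> A"
        obtain m n where mn: "x = (m, n)" by (cases x)
        define s where "s = (int n - int K, int K - int m, int m - int n)"
        have "s \<in> S"
          using x by (auto simp: A_def f_def mn s_def S_def)
        moreover have "(case s of (p, q, r) \<Rightarrow> (nat (int K + - q), nat (int K + p))) = x"
          by (simp add: s_def mn)
        moreover have "norm (f x) \<le> g K s"
        proof -
          have "norm (f x) = norm (Q (int n - int K) (int K - int m) (int m - int n)) *
              ((real K + 1) * (b (Suc K) * b m * b n))"
            by (simp add: f_def mn norm_mult b_def del: of_nat_Suc)
          also have "\<dots> \<le> norm (Q (int n - int K) (int K - int m) (int m - int n)) *
              ((real K + 1) * (b (Suc K) ^ 3 + b m ^ 3 + b n ^ 3))"
            by (intro mult_left_mono prod3_le_sum_power3) (auto simp: b_def)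
          also have "\<dots> = g K s"
            by (simp add: g_def s_def nat_add_distrib distrib_left)
          finally show ?thesis .
        qed
        ultimately show "\<exists>s\<in>S. (case s of (p, q, r) \<Rightarrow> (nat (int K + - q), nat (int K + p))) = x \<and> norm (f x) \<le> g K s"
          by blast
      qed
    qed (use S in \<open>auto simp: A_def\<close>)
    finally show "norm (\<Sum>(m, n)\<in>{..K} \<times> {..K}. of_nat (Suc K) * binom_coeff u (Suc K) * binom_coeff u m * binom_coeff u n *
     Q (int n - int K) (int K - int m) (int m - int n)) \<le> (\<Sum>s\<in>S. g K s)"
      by (simp add: f_def)
  qed
qed

lemma sum_rotate3: "(\<Sum>x\<in>A. \<Sum>y\<in>B. \<Sum>z\<in>C. f x y z) = (\<Sum>y\<in>B. \<Sum>z\<in>C. \<Sum>x\<in>A. f x y z)"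
proof -
  have "(\<Sum>x\<in>A. \<Sum>y\<in>B. \<Sum>z\<in>C. f x y z) = (\<Sum>y\<in>B. \<Sum>x\<in>A. \<Sum>z\<in>C. f x y z)"
    by (rule sum.swap)
  also have "\<dots> = (\<Sum>y\<in>B. \<Sum>z\<in>C. \<Sum>x\<in>A. f x y z)"
    by (intro sum.cong refl sum.swap)
  finally show ?thesis .
qed

text \<open>With \<open>c = binom_coeff u\<close>, the coefficient of \<open>G l\<close> for
  \<open>l < K\<close> is \<open>l * c l - (l + 1) * c (l + 1) = u * c l\<close>; at
  \<open>l = K\<close> the last term is left over. \<open>G (- 1)\<close> occurs only with the
  factor 0.\<close>

lemma binom_coeff_abel_summation:
  "(\<Sum>l\<le>K. of_nat l * binom_coeff u l * (G (int l) - G (int l - 1))) =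
   u * (\<Sum>l\<le>K. binom_coeff u l * G (int l)) + of_nat (Suc K) * binom_coeff u (Suc K) * G (int K)"
proof (induction K)
  case 0
  then show ?case
    using binom_coeff_Suc[of 0 u] by simp
next
  case (Suc K)
  define S where "S = u * (\<Sum>l\<le>K. binom_coeff u l * G (int l))"
  define B where "B = binom_coeff u (Suc K)"
  have "(\<Sum>l\<le>Suc K. of_nat l * binom_coeff u l * (G (int l) - G (int l - 1))) =
      (S + of_nat (Suc K) * B * G (int K)) + of_nat (Suc K) * B * (G (int (Suc K)) - G (int K))"
    using Suc.IH by (simp add: S_def B_def del: of_nat_Suc) simp
  also have "\<dots> = S + u * B * G (int (Suc K)) + (of_nat (Suc K) - u) * B * G (int (Suc K))"
    by (simp add: algebra_simps del: of_nat_Suc)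
  also have "(of_nat (Suc K) - u) * B = of_nat (Suc (Suc K)) * binom_coeff u (Suc (Suc K))"
    by (simp only: binom_coeff_Suc B_def)
  finally show ?case
    by (simp add: S_def B_def distrib_left mult.assoc)
qed

text \<open>Constant terms of \<open>x \<partial>/\<partial>x\<close> of anything vanish. Applied to \<open>h\<close> times the kernel this involves
  \<open>x/(x - y)\<close> and \<open>z/(x - z)\<close> times the kernel; cyclic symmetry turns the second into the first, and the
  hypothesis says that the resulting numerator is \<open>(y - x)/x\<close> times \<open>Q\<close>.  For \<open>Re u \<le> -1/3\<close> the
  individual series diverge, hence the cut-off at the cube \<open>l, m, n \<le> K\<close>.\<close>

lemma ct_pairing_by_parts:
  assumes u: "Re u > - 2 / 3" and h: "finite_support h" and Q: "finite_support Q"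
    and hQ: "\<And>p q r. h p q r - h q r p = Q (p + 1) (q - 1) r - Q p q r"
  shows "ct_pairing u (\<lambda>p q r. of_int p * h p q r) = u * ct_pairing u Q"
proof -
  define b where "b = binom_coeff u"
  have eq: "sum (triple_term u (\<lambda>p q r. of_int p * h p q r)) ({..K} \<times> {..K} \<times> {..K}) =
     u * sum (triple_term u Q) ({..K} \<times> {..K} \<times> {..K}) +
     (\<Sum>(m, n)\<in>{..K} \<times> {..K}. of_nat (Suc K) * b (Suc K) * b m * b n *
        Q (int n - int K) (int K - int m) (int m - int n))" for K
  proof -
    let ?C = "{..K} \<times> {..K} \<times> {..K}"
    \<comment> \<open>Here \<open>p = n - l\<close>. The part weighted by \<open>n\<close> is then
      rotated to be weighted by \<open>l\<close>, which the cube permits, and the hypothesis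
      \<open>hQ\<close> turns the difference into a difference of \<open>Q\<close> in
      \<open>l\<close>.\<close>
    have "sum (triple_term u (\<lambda>p q r. of_int p * h p q r)) ?C =
      (\<Sum>(l, m, n)\<in>?C. of_nat n * (h (int n - int l) (int l - int m) (int m - int n) * (b l * b m * b n))) -
      (\<Sum>(l, m, n)\<in>?C. of_nat l * (h (int n - int l) (int l - int m) (int m - int n) * (b l * b m * b n)))"
      unfolding sum_subtractf[symmetric]
      by (intro sum.cong refl) (auto simp: triple_term_def b_def algebra_simps)
    also have "(\<Sum>(l, m, n)\<in>?C. of_nat n * (h (int n - int l) (int l - int m) (int m - int n) * (b l * b m * b n))) =
      (\<Sum>(l, m, n)\<in>?C. of_nat l * (h (int l - int m) (int m - int n) (int n - int l) * (b l * b m * b n)))"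
      by (rule sum.reindex_bij_witness[where i = "\<lambda>(l, m, n). (m, n, l)" and j = "\<lambda>(l, m, n). (n, l, m)"]) auto
    also have "\<dots> - (\<Sum>(l, m, n)\<in>?C. of_nat l * (h (int n - int l) (int l - int m) (int m - int n) * (b l * b m * b n))) =
      (\<Sum>(l, m, n)\<in>?C. of_nat l * b l * (Q (int n - int l) (int l - int m) (int m - int n) -
          Q (int n - (int l - 1)) ((int l - 1) - int m) (int m - int n)) * (b m * b n))"
    proof -
      have "of_nat l * (h (int l - int m) (int m - int n) (int n - int l) * (b l * b m * b n)) -
          of_nat l * (h (int n - int l) (int l - int m) (int m - int n) * (b l * b m * b n)) =
        of_nat l * b l * (Q (int n - int l) (int l - int m) (int m - int n) -
          Q (int n - (int l - 1)) ((int l - 1) - int m) (int m - int n)) * (b m * b n)" for l m n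
      proof -
        have "Q (int n - int l) (int l - int m) (int m - int n) -
          Q (int n - (int l - 1)) ((int l - 1) - int m) (int m - int n) =
          h (int l - int m) (int m - int n) (int n - int l) - h (int n - int l) (int l - int m) (int m - int n)"
          using hQ[of "int n - int l" "int l - int m" "int m - int n"] by (simp add: algebra_simps)
        then show ?thesis by (simp only:) (simp add: algebra_simps)
      qed
      then show ?thesis
        unfolding sum_subtractf[symmetric] by (intro sum.cong refl) auto
    qed
    \<comment> \<open>With \<open>m\<close> and \<open>n\<close> fixed, the inner sum over
      \<open>l\<close> has the form required for Abel summation.\<close>
    also have "\<dots> = (\<Sum>(m, n)\<in>{..K} \<times> {..K}. (\<Sum>l\<le>K. of_nat l * b l * (Q (int n - int l) (int l - int m) (int m - int n) -
          Q (int n - (int l - 1)) ((int l - 1) - int m) (int m - int n))) * (b m * b n))"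
      unfolding sum.cartesian_product[symmetric] sum_distrib_right
      by (rule sum_rotate3)
    also have "\<dots> = (\<Sum>(m, n)\<in>{..K} \<times> {..K}. (u * (\<Sum>l\<le>K. b l * Q (int n - int l) (int l - int m) (int m - int n))
        + of_nat (Suc K) * b (Suc K) * Q (int n - int K) (int K - int m) (int m - int n)) * (b m * b n))"
      unfolding b_def by (simp only: binom_coeff_abel_summation[where G = "\<lambda>l. Q (int _ - l) (l - int _) _"])
    also have "\<dots> = u * (\<Sum>(m, n)\<in>{..K} \<times> {..K}. \<Sum>l\<le>K. b l * Q (int n - int l) (int l - int m) (int m - int n) * (b m * b n))
        + (\<Sum>(m, n)\<in>{..K} \<times> {..K}. of_nat (Suc K) * b (Suc K) * b m * b n * Q (int n - int K) (int K - int m) (int m - int n))"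
      unfolding sum_distrib_left sum.distrib[symmetric]
      by (intro sum.cong refl) (auto simp: sum_distrib_left sum_distrib_right algebra_simps simp del: of_nat_Suc)
    also have "(\<Sum>(m, n)\<in>{..K} \<times> {..K}. \<Sum>l\<le>K. b l * Q (int n - int l) (int l - int m) (int m - int n) * (b m * b n)) =
        sum (triple_term u Q) ?C"
    proof -
      have "sum (triple_term u Q) ?C = (\<Sum>(l, m, n)\<in>?C. b l * Q (int n - int l) (int l - int m) (int m - int n) * (b m * b n))"
        by (intro sum.cong refl) (auto simp: triple_term_def b_def mult_ac)
      then show ?thesis
        unfolding sum.cartesian_product[symmetric]
        by (simp only:) (rule sum_rotate3[symmetric])
    qed
    finally show ?thesis .
  qed
  have "(\<lambda>K. sum (triple_term u (\<lambda>p q r. of_int p * h p q r)) ({..K} \<times> {..K} \<times> {..K})) \<longlonglongrightarrow> u * ct_pairing u Q + 0"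
    unfolding eq b_def by (intro tendsto_intros sum_triple_term_tendsto boundary_tendsto_0 u Q)
  moreover have "(\<lambda>K. sum (triple_term u (\<lambda>p q r. of_int p * h p q r)) ({..K} \<times> {..K} \<times> {..K})) \<longlonglongrightarrow>
      ct_pairing u (\<lambda>p q r. of_int p * h p q r)"
    by (intro sum_triple_term_tendsto finite_support_mult u h)
  ultimately show ?thesis
    using LIMSEQ_unique by fastforce
qed

section \<open>Aomoto's recursion\<close>

text \<open>The recurrence for \<open>w\<close> is the coefficient form of
  \<open>(1 - x) x f' = - (b + a x) f\<close>, solved by \<open>x^(-b) (1 - x)^(a + b)\<close>. The
  three relations from integration by parts are multiplied together.\<close>

lemma aomoto_recursion:
  fixes a b :: nat and w :: "int \<Rightarrow> complex"
  assumes u: "Re u > - 2 / 3" and fin: "finite {p. w p \<noteq> 0}"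
    and rec: "\<And>p. (of_int p + of_nat b) * w p = (of_int p - 1 - of_nat a) * w (p - 1)"
  shows "(of_nat a + 1) * (2 * (of_nat a + 1) + u) * (of_nat a + 1 + u) *
           ct_pairing u (\<lambda>p q r. w (p - 1) * w (q - 1) * w (r - 1)) =
         - (of_nat b * (2 * of_nat b + u) * (of_nat b + u) * ct_pairing u (\<lambda>p q r. w p * w q * w r))"
proof -
  define w' where "w' = (\<lambda>p. w (p - 1))"
  define B where "B = (\<lambda>\<alpha> \<beta> \<gamma>. ct_pairing u (\<lambda>p q r. \<alpha> p * \<beta> q * \<gamma> r))"
  define X0 X1 X2 X3 where "X0 = B w w w" and "X1 = B w' w w" and "X2 = B w' w' w" and "X3 = B w' w' w'"
  \<comment> \<open>If \<open>w\<close> belongs to \<open>f\<close>, then \<open>w'\<close> belongs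
    to \<open>x f\<close>, \<open>d\<close> to \<open>(1 - x) f\<close>, and \<open>e\<close> to
    \<open>x \<partial>/\<partial>x\<close> of \<open>(1 - x) f\<close>. By cyclic symmetry
    \<open>X1\<close> and \<open>X2\<close> are one third of \<open>A 1\<close> and
    \<open>A 2\<close>.\<close>
  define d where "d = (\<lambda>p. w p - w' p)"
  define e where "e = (\<lambda>p. - of_nat b * w p - (of_nat a + 1) * w' p)"
  have fin': "finite {p. w' p \<noteq> 0}"
  proof -
    have "{p. w' p \<noteq> 0} = (\<lambda>p. p + 1) ` {p. w p \<noteq> 0}"
      by (auto simp: w'_def image_iff) (metis diff_add_cancel)
    then show ?thesis using fin by simp
  qed
  have find: "finite {p. d p \<noteq> 0}"
    by (rule finite_subset[OF _ finite_UnI[OF fin fin']]) (auto simp: d_def)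
  note fins = fin fin' find finite_support_prod finite_support_add
  have pd: "of_int p * d p = e p" for p
    using rec[of p] by (simp add: d_def e_def w'_def algebra_simps)
  have rot: "B \<alpha> \<beta> \<gamma> = B \<gamma> \<alpha> \<beta>" for \<alpha> \<beta> \<gamma>
    using ct_pairing_rotate[of u "\<lambda>p q r. \<alpha> p * \<beta> q * \<gamma> r"] by (simp add: B_def mult_ac)
  have Be: "B e \<beta> \<gamma> = - of_nat b * B w \<beta> \<gamma> - (of_nat a + 1) * B w' \<beta> \<gamma>"
    if "finite {p. \<beta> p \<noteq> 0}" "finite {p. \<gamma> p \<noteq> 0}" for \<beta> \<gamma>
  proof -
    have "B e \<beta> \<gamma> = ct_pairing u (\<lambda>p q r. - of_nat b * (w p * \<beta> q * \<gamma> r) + - (of_nat a + 1) * (w' p * \<beta> q * \<gamma> r))"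
    proof -
      have "e p * \<beta> q * \<gamma> r = - of_nat b * (w p * \<beta> q * \<gamma> r) + - (of_nat a + 1) * (w' p * \<beta> q * \<gamma> r)" for p q r
        by (simp add: e_def algebra_simps)
      then show ?thesis by (simp only: B_def)
    qed
    also have "\<dots> = - of_nat b * B w \<beta> \<gamma> + - (of_nat a + 1) * B w' \<beta> \<gamma>"
      unfolding B_def
      by (subst ct_pairing_add) (intro u finite_support_mult finite_support_prod that fins | simp only: ct_pairing_cmult)+
    finally show ?thesis by (simp only: mult_minus_left diff_conv_add_uminus)
  qed
  have e1: "B e w w = u * B w' w w"
  proof -
    have "ct_pairing u (\<lambda>p q r. of_int p * (d p * w q * w r)) = u * ct_pairing u (\<lambda>p q r. w' p * w q * w r)"
      by (rule ct_pairing_by_parts[OF u]; (intro fins)?) (simp add: d_def w'_def algebra_simps)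
    then show ?thesis
      by (simp add: B_def pd[symmetric] mult.assoc)
  qed
  have e2: "B e w' w + B e w w' = u * (B w' w w + B w' w w')"
  proof -
    have "ct_pairing u (\<lambda>p q r. of_int p * (d p * w' q * w r + d p * w q * w' r)) =
        u * ct_pairing u (\<lambda>p q r. w' p * w q * w r + w' p * w q * w' r)"
      by (rule ct_pairing_by_parts[OF u]; (intro fins)?) (simp add: d_def w'_def algebra_simps)
    also have "ct_pairing u (\<lambda>p q r. w' p * w q * w r + w' p * w q * w' r) = B w' w w + B w' w w'"
      unfolding B_def by (intro ct_pairing_add u fins)
    also have "ct_pairing u (\<lambda>p q r. of_int p * (d p * w' q * w r + d p * w q * w' r)) =
        ct_pairing u (\<lambda>p q r. e p * w' q * w r + e p * w q * w' r)"
      by (simp add: pd[symmetric] algebra_simps)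
    also have "\<dots> = B e w' w + B e w w'"
    proof -
      have "finite {p. e p \<noteq> 0}"
        by (rule finite_subset[OF _ find]) (auto simp: pd[symmetric])
      then show ?thesis
        unfolding B_def by (intro ct_pairing_add u fins)
    qed
    finally show ?thesis .
  qed
  have e3: "B e w' w' = u * B w' w w'"
  proof -
    have "ct_pairing u (\<lambda>p q r. of_int p * (d p * w' q * w' r)) = u * ct_pairing u (\<lambda>p q r. w' p * w q * w' r)"
      by (rule ct_pairing_by_parts[OF u]; (intro fins)?) (simp add: d_def w'_def algebra_simps)
    then show ?thesis
      by (simp add: B_def pd[symmetric] mult.assoc)
  qed
  have r: "B w w' w = X1" "B w w w' = X1" "B w' w w' = X2" "B w w' w' = X2"
    using rot[of w w w'] rot[of w w' w] rot[of w' w w'] rot[of w w' w'] by (simp_all add: X1_def X2_def)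
  have "(of_nat a + 1 + u) * X1 = - of_nat b * X0"
    using e1 unfolding Be[OF fin fin] by (simp add: r X0_def[symmetric] X1_def[symmetric] algebra_simps)
  moreover have "(2 * (of_nat a + 1) + u) * X2 = - (2 * of_nat b + u) * X1"
    using e2 unfolding Be[OF fin fin'] Be[OF fin' fin] r X1_def[symmetric] X2_def[symmetric]
    by algebra
  moreover have "(of_nat a + 1) * X3 = - (of_nat b + u) * X2"
    using e3 unfolding Be[OF fin' fin'] r X2_def[symmetric] X3_def[symmetric]
    by algebra
  ultimately have "(of_nat a + 1) * (2 * (of_nat a + 1) + u) * (of_nat a + 1 + u) * X3 =
      - (of_nat b * (2 * of_nat b + u) * (of_nat b + u) * X0)"
    by algebra
  then show ?thesis
    by (simp add: X3_def X0_def B_def w'_def)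
qed

section \<open>The factors \<open>(1 - x)^a (1 - 1/x)^b\<close> and the induction on
  \<open>b\<close>\<close>

text \<open>The coefficient of \<open>x^p\<close> in
  \<open>(1 - x)^a (1 - 1/x)^b = (-1)^b x^(-b) (1 - x)^(a + b)\<close>. The case distinction is
  needed because \<open>nat\<close> sends negative arguments to 0, where the binomial is 1.\<close>

definition laurent_coeff :: "nat \<Rightarrow> nat \<Rightarrow> int \<Rightarrow> complex" where
  "laurent_coeff a b p = (if p < - int b then 0 else (- 1) ^ nat \<bar>p\<bar> * of_nat ((a + b) choose nat (p + int b)))"

lemma power_abs_minus_one_diff: "(- 1 :: complex) ^ nat \<bar>p - 1\<bar> = - ((- 1) ^ nat \<bar>p\<bar>)"
  by (cases "even p") (auto simp: minus_one_power_iff even_nat_iff)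

lemma laurent_coeff_rec:
  "(of_int p + of_nat b) * laurent_coeff a b p = (of_int p - 1 - of_nat a) * laurent_coeff a b (p - 1)"
proof -
  consider "p < - int b" | "p = - int b" | k where "p = int k + 1 - int b"
    by (metis add.commute add_diff_cancel_left' diff_add_cancel linorder_less_linear zless_iff_Suc_zadd
        of_nat_Suc diff_minus_eq_add)
  then show ?thesis
  proof cases
    case 3
    define s :: complex where "s = (- 1) ^ nat \<bar>p\<bar>"
    have "of_nat (Suc k) * (of_nat ((a + b) choose Suc k) :: complex) = (of_nat (a + b) - of_nat k) * of_nat ((a + b) choose k)"
    proof (cases "k \<le> a + b")
      case True
      have "Suc k * ((a + b) choose Suc k) = (a + b - k) * ((a + b) choose k)"
        by (metis binomial_absorb_comp binomial_absorption mult.commute Suc_times_binomial_eq binomial_absorb_comp)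
      then have "of_nat (Suc k * ((a + b) choose Suc k)) = (of_nat ((a + b - k) * ((a + b) choose k)) :: complex)"
        by (simp only:)
      then show ?thesis
        using True by (simp only: of_nat_mult of_nat_diff)
    qed (simp add: binomial_eq_0)
    moreover have "laurent_coeff a b p = s * of_nat ((a + b) choose Suc k)"
    proof -
      have "nat (p + int b) = Suc k" "\<not> p < - int b" by (auto simp: 3)
      then show ?thesis by (simp only: laurent_coeff_def s_def if_False)
    qed
    moreover have "laurent_coeff a b (p - 1) = - s * of_nat ((a + b) choose k)"
      unfolding s_def power_abs_minus_one_diff[symmetric] by (simp add: laurent_coeff_def 3)
    moreover have "of_int p + of_nat b = (of_nat (Suc k) :: complex)"
      "of_int p - 1 - of_nat a = - (of_nat (a + b) - of_nat k :: complex)"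
      by (simp_all add: 3)
    ultimately show ?thesis
      by (simp only: mult_minus_left mult_minus_right minus_minus mult.left_commute[of _ s])
  qed (auto simp: laurent_coeff_def)
qed

lemma finite_laurent_coeff: "finite {p. laurent_coeff a b p \<noteq> 0}"
proof (rule finite_subset)
  show "{p. laurent_coeff a b p \<noteq> 0} \<subseteq> {- int b..int a}"
    by (auto simp: laurent_coeff_def binomial_eq_0_iff split: if_splits)
qed auto

text \<open>Reflects \<open>x (1 - 1/x) = - (1 - x)\<close>.\<close>

lemma laurent_coeff_shift: "laurent_coeff a (Suc b) (p - 1) = - laurent_coeff (Suc a) b p"
proof -
  have "p - 1 + int (Suc b) = p + int b" by simp
  then show ?thesis
    by (auto simp: laurent_coeff_def power_abs_minus_one_diff)
qed

text \<open>The three exponents sum to 0 and none may be negative, so \<open>l = m = n\<close>; the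
  coefficients at 0 are 1.\<close>

lemma ct_pairing_laurent_coeff_0:
  assumes "Re u > - 2 / 3"
  shows "ct_pairing u (\<lambda>p q r. laurent_coeff a 0 p * laurent_coeff a 0 q * laurent_coeff a 0 r) = dixon_sum u 0"
proof -
  define H where "H = (\<lambda>p q r. laurent_coeff a 0 p * laurent_coeff a 0 q * laurent_coeff a 0 r)"
  have "ct_pairing u H = infsum (triple_term u H) (range (\<lambda>n. (n, n, n)))"
    unfolding ct_pairing_def
    by (intro infsum_cong_neutral) (auto simp: triple_term_def H_def laurent_coeff_def image_iff split: if_splits)
  also have "\<dots> = infsum (dixon_term u 0) UNIV"
  proof (subst infsum_reindex)
    show "infsum (triple_term u H \<circ> (\<lambda>n. (n, n, n))) UNIV = infsum (dixon_term u 0) UNIV"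
      by (intro infsum_cong)
         (simp add: triple_term_def H_def laurent_coeff_def binom_coeff_power3[symmetric] power3_eq_cube)
  qed (auto simp: inj_on_def)
  also have "\<dots> = dixon_sum u 0"
    unfolding dixon_sum_def
    by (intro infsumI norm_summable_imp_has_sum summable_norm_dixon_term assms summable_sums
        summable_norm_cancel[OF summable_norm_dixon_term])
  finally show ?thesis by (simp only: H_def)
qed

text \<open>The recursion trades a unit of \<open>b\<close> for a unit of \<open>a\<close>, so the
  induction on \<open>b\<close> keeps \<open>a\<close> arbitrary and the numerators, which depend on
  \<open>a + b\<close>, unchanged.\<close>

lemma ct_pairing_laurent_coeff:
  assumes "Re u > - 2 / 3"
  shows "ct_pairing u (\<lambda>p q r. laurent_coeff a b p * laurent_coeff a b q * laurent_coeff a b r) =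
    dixon_sum u 0 * (\<Prod>i = 0..2::nat. pochhammer (1 + 1 / 2 * of_nat i * u) (a + b) /
        (pochhammer (1 + 1 / 2 * of_nat i * u) a * pochhammer (1 + 1 / 2 * of_nat i * u) b))"
proof -
  define F where "F = (\<lambda>a b. ct_pairing u (\<lambda>p q r. laurent_coeff a b p * laurent_coeff a b q * laurent_coeff a b r))"
  define c :: "nat \<Rightarrow> complex" where "c = (\<lambda>i. 1 + 1 / 2 * of_nat i * u)"
  have nz: "c i + of_nat k \<noteq> 0" if "i \<le> 2" for i k
  proof -
    have "i = 0 \<or> i = 1 \<or> i = 2" using that by auto
    then have "Re (c i + of_nat k) > 0"
      using assms by (auto simp: c_def)
    then show ?thesis by force
  qed
  have pnz: "pochhammer (c i) k \<noteq> 0" if "i \<le> 2" for i k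
    using nz[OF that] unfolding pochhammer_eq_0_iff by (metis add.left_inverse)
  have rec: "F a (Suc b) * (\<Prod>i=0..2. c i + of_nat b) = F (Suc a) b * (\<Prod>i=0..2. c i + of_nat a)" for a b
  proof -
    have "ct_pairing u (\<lambda>p q r. laurent_coeff a (Suc b) (p - 1) * laurent_coeff a (Suc b) (q - 1) * laurent_coeff a (Suc b) (r - 1)) =
      ct_pairing u (\<lambda>p q r. - 1 * (laurent_coeff (Suc a) b p * laurent_coeff (Suc a) b q * laurent_coeff (Suc a) b r))"
      by (simp add: laurent_coeff_shift)
    also have "\<dots> = - F (Suc a) b"
      using ct_pairing_cmult[of u "- 1"] by (simp add: F_def)
    finally have "(of_nat a + 1) * (2 * (of_nat a + 1) + u) * (of_nat a + 1 + u) * F (Suc a) b =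
        of_nat (Suc b) * (2 * of_nat (Suc b) + u) * (of_nat (Suc b) + u) * F a (Suc b)"
      using aomoto_recursion[OF assms finite_laurent_coeff laurent_coeff_rec, of a "Suc b"]
      by (simp add: F_def)
    \<comment> \<open>The factor 2 clears the denominator of \<open>c 1 = 1 + u / 2\<close>.\<close>
    moreover have "2 * (\<Prod>i=0..2. c i + of_nat a) = (of_nat a + 1) * (2 * (of_nat a + 1) + u) * (of_nat a + 1 + u)" for a
      by (simp add: c_def numeral_2_eq_2 algebra_simps)
    ultimately have "2 * (F a (Suc b) * (\<Prod>i=0..2. c i + of_nat b)) = 2 * (F (Suc a) b * (\<Prod>i=0..2. c i + of_nat a))"
      by (simp add: mult.left_commute[of 2] add.commute mult.commute)
    then show ?thesis by simp
  qed
  have "F a b = dixon_sum u 0 * (\<Prod>i=0..2. pochhammer (c i) (a + b) / (pochhammer (c i) a * pochhammer (c i) b))"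
  proof (induction b arbitrary: a)
    case 0
    have "(\<Prod>i=0..2. pochhammer (c i) (a + 0) / (pochhammer (c i) a * pochhammer (c i) 0)) = 1"
      using pnz by (intro prod.neutral) auto
    then show ?case
      by (simp add: F_def ct_pairing_laurent_coeff_0[OF assms])
  next
    case (Suc b)
    have P: "(\<Prod>i=0..2. c i + of_nat b) \<noteq> 0"
      using nz by simp
    have "F a (Suc b) * (\<Prod>i=0..2. c i + of_nat b) = dixon_sum u 0 *
       (\<Prod>i=0..2. pochhammer (c i) (Suc a + b) / (pochhammer (c i) (Suc a) * pochhammer (c i) b) * (c i + of_nat a))"
      unfolding rec Suc.IH prod.distrib by (simp only: mult.assoc)
    also have "(\<Prod>i=0..2. pochhammer (c i) (Suc a + b) / (pochhammer (c i) (Suc a) * pochhammer (c i) b) * (c i + of_nat a)) =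
       (\<Prod>i=0..2. pochhammer (c i) (a + Suc b) / (pochhammer (c i) a * pochhammer (c i) (Suc b)) * (c i + of_nat b))"
    proof (intro prod.cong refl)
      fix i :: nat assume "i \<in> {0..2}"
      then have i: "i \<le> 2" by simp
      show "pochhammer (c i) (Suc a + b) / (pochhammer (c i) (Suc a) * pochhammer (c i) b) * (c i + of_nat a) =
        pochhammer (c i) (a + Suc b) / (pochhammer (c i) a * pochhammer (c i) (Suc b)) * (c i + of_nat b)"
        using nz[OF i] pnz[OF i] by (simp add: pochhammer_Suc[of _ a] pochhammer_Suc[of _ b])
    qed
    finally have "F a (Suc b) * (\<Prod>i=0..2. c i + of_nat b) =
        (dixon_sum u 0 * (\<Prod>i=0..2. pochhammer (c i) (a + Suc b) / (pochhammer (c i) a * pochhammer (c i) (Suc b)))) *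
        (\<Prod>i=0..2. c i + of_nat b)"
      by (simp only: prod.distrib mult.assoc)
    with P show ?case
      by (simp only: mult_right_cancel[OF P])
  qed
  then show ?thesis
    by (simp only: F_def c_def)
qed


text \<open>Vandermonde's identity after reflecting \<open>b choose j\<close> to
  \<open>b choose (b - j)\<close>, with total index \<open>r = p + b\<close>; the sign depends only
  on the parity of \<open>i - j = p\<close>.\<close>

lemma laurent_coeff_convolution:
  "(\<Sum>(i, j)\<in>{(i, j). i \<le> a \<and> j \<le> b \<and> int i - int j = p}.
      binom_coeff (of_nat a) i * binom_coeff (of_nat b) j) = laurent_coeff a b p"
proof (cases "p < - int b")
  case True
  then have "{(i, j). i \<le> a \<and> j \<le> b \<and> int i - int j = p} = {}"
    by auto
  then show ?thesis
    by (simp only: sum.empty) (simp add: laurent_coeff_def True)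
next
  case False
  define r where "r = nat (p + int b)"
  have p: "p = int r - int b"
    using False by (simp add: r_def)
  have sym: "b choose (r - i) = b choose j" if "j \<le> b" "int i + int b = int j + int r" for i j
  proof -
    have "r - i = b - j" using that by linarith
    then show ?thesis using binomial_symmetric[OF that(1)] by simp
  qed
  have "(\<Sum>(i, j)\<in>{(i, j). i \<le> a \<and> j \<le> b \<and> int i - int j = p}.
      binom_coeff (of_nat a) i * binom_coeff (of_nat b) j) =
    (\<Sum>(i, j)\<in>{(i, j). i \<le> a \<and> j \<le> b \<and> int i - int j = p}. (- 1) ^ nat \<bar>p\<bar> * of_nat ((a choose i) * (b choose j)))"
  proof (intro sum.cong refl)
    fix x assume "x \<in> {(i, j). i \<le> a \<and> j \<le> b \<and> int i - int j = p}"
    then obtain i j where x: "x = (i, j)" "p = int i - int j" by auto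
    have "(- 1 :: complex) ^ i * (- 1) ^ j = (- 1) ^ nat \<bar>p\<bar>"
      unfolding power_add[symmetric] minus_one_power_iff by (simp add: x even_nat_iff)
    then have "binom_coeff (of_nat a) i * binom_coeff (of_nat b) j = (- 1) ^ nat \<bar>p\<bar> * of_nat ((a choose i) * (b choose j))"
      by (simp add: binom_coeff_def binomial_gbinomial mult_ac)
    then show "(case x of (i, j) \<Rightarrow> binom_coeff (of_nat a) i * binom_coeff (of_nat b) j) =
        (case x of (i, j) \<Rightarrow> (- 1) ^ nat \<bar>p\<bar> * of_nat ((a choose i) * (b choose j)))"
      by (simp add: x)
  qed
  also have "\<dots> = (\<Sum>k\<in>{k. k \<le> r \<and> k \<le> a \<and> r - k \<le> b}. (- 1) ^ nat \<bar>p\<bar> * of_nat ((a choose k) * (b choose (r - k))))"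
    by (rule sum.reindex_bij_witness[where i = "\<lambda>k. (k, b - (r - k))" and j = fst])
       (auto simp: p of_nat_diff algebra_simps sym)
  also have "\<dots> = (\<Sum>k\<le>r. (- 1) ^ nat \<bar>p\<bar> * of_nat ((a choose k) * (b choose (r - k))))"
    by (intro sum.mono_neutral_left) (auto simp: binomial_eq_0_iff)
  also have "\<dots> = (- 1) ^ nat \<bar>p\<bar> * of_nat ((a + b) choose r)"
    by (simp only: sum_distrib_left[symmetric] of_nat_sum[symmetric] vandermonde)
  finally show ?thesis
    using False by (simp add: laurent_coeff_def r_def)
qed


section \<open>The expanded product\<close>

text \<open>Groups the indices by variable: once \<open>l, m, n\<close> are fixed, the condition on
  the monomial constrains each pair \<open>(i, j)\<close> separately.\<close>

definition dyson_index :: "(nat \<times> nat \<times> nat) \<times> (nat \<times> nat) \<times> (nat \<times> nat) \<times> (nat \<times> nat) \<Rightarrow> nat list" where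
  "dyson_index = (\<lambda>((l, m, n), (i1, j1), (i2, j2), (i3, j3)). [i1, i2, i3, j1, j2, j3, l, m, n])"

definition diff_pairs :: "int \<Rightarrow> (nat \<times> nat) set" where
  "diff_pairs p = {(i, j). int i - int j = p}"

text \<open>The finite part of \<open>diff_pairs p\<close> outside which the binomial coefficients
  for \<open>a\<close> or \<open>b\<close> vanish.\<close>

definition diff_pairs_bounded :: "nat \<Rightarrow> nat \<Rightarrow> int \<Rightarrow> (nat \<times> nat) set" where
  "diff_pairs_bounded a b p = {(i, j). i \<le> a \<and> j \<le> b \<and> int i - int j = p}"

lemma term_monomial_dyson_product:
  "term_monomial (dyson_product a b u) [i1, i2, i3, j1, j2, j3, l, m, n] = 0 \<longleftrightarrow>
     int i1 - int j1 = int n - int l \<and> int i2 - int j2 = int l - int m \<and> int i3 - int j3 = int m - int n"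
  by (auto simp: term_monomial_def dyson_product_def Let_def vec_eq_iff forall_3 eval_nat_numeral lessThan_Suc)

lemma term_coeff_dyson_product:
  "term_coeff (dyson_product a b u) [i1, i2, i3, j1, j2, j3, l, m, n] =
     (binom_coeff u l * binom_coeff u m * binom_coeff u n) *
     ((binom_coeff (of_nat a) i1 * binom_coeff (of_nat b) j1) *
      ((binom_coeff (of_nat a) i2 * binom_coeff (of_nat b) j2) *
       (binom_coeff (of_nat a) i3 * binom_coeff (of_nat b) j3)))"
  by (simp add: term_coeff_def dyson_product_def Let_def eval_nat_numeral lessThan_Suc binom_coeff_def mult_ac)

lemma bij_betw_dyson_index:
  "bij_betw dyson_index
     (SIGMA (l, m, n):UNIV. diff_pairs (int n - int l) \<times> diff_pairs (int l - int m) \<times> diff_pairs (int m - int n))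
     (constant_terms (dyson_product a b u))"
proof (rule bij_betwI')
  fix ns assume ns: "ns \<in> constant_terms (dyson_product a b u)"
  then have "length ns = 9"
    by (simp add: constant_terms_def dyson_product_def Let_def)
  then obtain i1 i2 i3 j1 j2 j3 l m n where eq: "ns = [i1, i2, i3, j1, j2, j3, l, m, n]"
    by (auto simp: eval_nat_numeral length_Suc_conv)
  show "\<exists>x\<in>SIGMA (l, m, n):UNIV. diff_pairs (int n - int l) \<times> diff_pairs (int l - int m) \<times> diff_pairs (int m - int n).
      ns = dyson_index x"
    using ns unfolding constant_terms_def
    by (intro bexI[of _ "((l, m, n), (i1, j1), (i2, j2), (i3, j3))"])
       (auto simp: eq dyson_index_def diff_pairs_def term_monomial_dyson_product)
next
  fix x
  assume "x \<in> (SIGMA (l, m, n):UNIV. diff_pairs (int n - int l) \<times> diff_pairs (int l - int m) \<times> diff_pairs (int m - int n))"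
  then show "dyson_index x \<in> constant_terms (dyson_product a b u)"
    by (auto simp: dyson_index_def diff_pairs_def constant_terms_def term_monomial_dyson_product)
       (simp add: dyson_product_def Let_def)
qed (auto simp: dyson_index_def)

lemma finite_diff_pairs_bounded: "finite (diff_pairs_bounded a b p)"
  by (rule finite_subset[of _ "{..a} \<times> {..b}"]) (auto simp: diff_pairs_bounded_def)

lemma sum_times3:
  fixes f :: "'a \<Rightarrow> 'b :: comm_semiring_0"
  shows "(\<Sum>(s, t, v)\<in>A \<times> B \<times> C. c * (f s * (f t * f v))) = c * (sum f A * (sum f B * sum f C))"
  by (simp only: sum.cartesian_product[symmetric] sum_distrib_left[symmetric] sum_distrib_right[symmetric])

lemma infsum_dyson_product:
  assumes u: "Re u > - 2 / 3"
  shows "(\<lambda>ns. norm (term_coeff (dyson_product a b u) ns)) summable_on constant_terms (dyson_product a b u)"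
    and "infsum (term_coeff (dyson_product a b u)) (constant_terms (dyson_product a b u)) =
      ct_pairing u (\<lambda>p q r. laurent_coeff a b p * laurent_coeff a b q * laurent_coeff a b r)"
proof -
  define T where "T = (SIGMA (l, m, n):UNIV. diff_pairs (int n - int l) \<times> diff_pairs (int l - int m) \<times> diff_pairs (int m - int n))"
  define R where "R = diff_pairs_bounded a b"
  define S where "S = (\<lambda>(l, m, n). R (int n - int l) \<times> R (int l - int m) \<times> R (int m - int n))"
  define g :: "nat \<times> nat \<Rightarrow> complex" where "g = (\<lambda>(i, j). binom_coeff (of_nat a) i * binom_coeff (of_nat b) j)"
  define f where "f = (\<lambda>((l, m, n), (s, t, v)). (binom_coeff u l * binom_coeff u m * binom_coeff u n) * (g s * (g t * g v)))"
  have f: "term_coeff (dyson_product a b u) (dyson_index x) = f x" for x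
    by (cases x) (auto simp: dyson_index_def term_coeff_dyson_product f_def g_def)
  have sub: "Sigma UNIV S \<subseteq> T"
    by (auto simp: S_def R_def T_def diff_pairs_def diff_pairs_bounded_def)
  have zero: "f x = 0" if "x \<in> T - Sigma UNIV S" for x
  proof -
    obtain l m n i1 i2 i3 j1 j2 j3 where x: "x = ((l, m, n), (i1, j1), (i2, j2), (i3, j3))"
      by (metis prod.exhaust)
    have "\<not> (i1 \<le> a \<and> j1 \<le> b \<and> i2 \<le> a \<and> j2 \<le> b \<and> i3 \<le> a \<and> j3 \<le> b)"
      using that by (auto simp: x T_def S_def R_def diff_pairs_def diff_pairs_bounded_def)
    then show ?thesis
      by (auto simp: x f_def g_def binom_coeff_def binomial_gbinomial[symmetric] binomial_eq_0_iff)
  qed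
  have fin: "finite (S x)" for x
    by (cases x) (auto simp: S_def R_def finite_diff_pairs_bounded)
  have abs: "(\<lambda>x. norm (f x)) summable_on Sigma UNIV S"
  proof (intro Infinite_Sum.abs_summable_on_Sigma_iff[THEN iffD2] conjI ballI)
    \<comment> \<open>Summing norms over the finite inner sets gives the norm of a
      \<open>triple_term\<close> whose Laurent polynomial has the coefficients \<open>V\<close>, so
      absolute convergence follows from that of the pairing.\<close>
    define V where "V = (\<lambda>p. of_real (\<Sum>s\<in>R p. norm (g s)) :: complex)"
    have "V p = 0" if "p \<notin> {- int b..int a}" for p
    proof -
      have "R p = {}"
        using that by (auto simp: R_def diff_pairs_bounded_def)
      then show ?thesis by (simp only: V_def sum.empty of_real_0)
    qed
    then have "{p. V p \<noteq> 0} \<subseteq> {- int b..int a}"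
      by blast
    then have V: "finite {p. V p \<noteq> 0}"
      by (rule finite_subset) simp
    have normV: "norm (V p) = (\<Sum>s\<in>R p. norm (g s))" for p
      by (simp add: V_def sum_nonneg del: of_real_sum)
    have "infsum (\<lambda>y. norm (f (x, y))) (S x) = norm (triple_term u (\<lambda>p q r. V p * V q * V r) x)" for x
    proof -
      obtain l m n where x: "x = (l, m, n)" by (cases x)
      have "infsum (\<lambda>y. norm (f (x, y))) (S x) = (\<Sum>y\<in>S x. norm (f (x, y)))"
        using fin by simp
      also have "\<dots> = (\<Sum>(s, t, v)\<in>R (int n - int l) \<times> R (int l - int m) \<times> R (int m - int n).
          norm (binom_coeff u l * binom_coeff u m * binom_coeff u n) * (norm (g s) * (norm (g t) * norm (g v))))"
        by (intro sum.cong) (auto simp: x S_def f_def norm_mult)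
      also have "\<dots> = norm (binom_coeff u l * binom_coeff u m * binom_coeff u n) *
          (norm (V (int n - int l)) * (norm (V (int l - int m)) * norm (V (int m - int n))))"
        by (simp only: sum_times3 normV)
      finally show ?thesis
        by (simp add: x triple_term_def norm_mult mult_ac)
    qed
    then show "(\<lambda>x. norm (infsum (\<lambda>y. norm (f (x, y))) (S x))) summable_on UNIV"
      using summable_on_norm_triple_term[OF u finite_support_prod[OF V V V]] by simp
  qed (use fin in auto)
  have "(\<lambda>x. norm (f x)) summable_on T"
    using abs by (rule summable_on_cong_neutral[THEN iffD1, rotated -1]) (use sub zero in auto)
  then have "(\<lambda>x. norm (term_coeff (dyson_product a b u) (dyson_index x))) summable_on T"
    by (simp only: f)
  then show "(\<lambda>ns. norm (term_coeff (dyson_product a b u) ns)) summable_on constant_terms (dyson_product a b u)"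
    using summable_on_reindex_bij_betw[OF bij_betw_dyson_index[of a b u, folded T_def],
        of "\<lambda>ns. norm (term_coeff (dyson_product a b u) ns)"] by blast
  have "infsum (term_coeff (dyson_product a b u)) (constant_terms (dyson_product a b u)) =
      infsum (\<lambda>x. term_coeff (dyson_product a b u) (dyson_index x)) T"
    by (rule infsum_reindex_bij_betw[OF bij_betw_dyson_index[of a b u, folded T_def], symmetric])
  also have "\<dots> = infsum f (Sigma UNIV S)"
    unfolding f by (intro infsum_cong_neutral) (use sub zero in auto)
  \<comment> \<open>Fubini, justified by \<open>abs\<close>; the inner sum factors over the three
    variables into Laurent coefficients.\<close>
  also have "\<dots> = infsum (\<lambda>x. infsum (\<lambda>y. f (x, y)) (S x)) UNIV"
    using infsum_Sigma_banach[OF abs_summable_summable[OF abs]] by simp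
  also have "(\<lambda>x. infsum (\<lambda>y. f (x, y)) (S x)) =
      triple_term u (\<lambda>p q r. laurent_coeff a b p * laurent_coeff a b q * laurent_coeff a b r)"
  proof
    fix x :: "nat \<times> nat \<times> nat"
    obtain l m n where x: "x = (l, m, n)" by (cases x)
    have L: "sum g (R p) = laurent_coeff a b p" for p
      unfolding g_def R_def diff_pairs_bounded_def by (rule laurent_coeff_convolution)
    have "infsum (\<lambda>y. f (x, y)) (S x) = (\<Sum>y\<in>S x. f (x, y))"
      using fin by simp
    also have "\<dots> = (\<Sum>(s, t, v)\<in>R (int n - int l) \<times> R (int l - int m) \<times> R (int m - int n).
          (binom_coeff u l * binom_coeff u m * binom_coeff u n) * (g s * (g t * g v)))"
      by (intro sum.cong) (auto simp: x S_def f_def)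
    finally show "infsum (\<lambda>y. f (x, y)) (S x) =
        triple_term u (\<lambda>p q r. laurent_coeff a b p * laurent_coeff a b q * laurent_coeff a b r) x"
      by (simp only: sum_times3 L) (simp add: x triple_term_def mult_ac)
  qed
  finally show "infsum (term_coeff (dyson_product a b u)) (constant_terms (dyson_product a b u)) =
      ct_pairing u (\<lambda>p q r. laurent_coeff a b p * laurent_coeff a b q * laurent_coeff a b r)"
    by (simp only: ct_pairing_def)
qed

theorem proposition4p1:
  fixes a b :: nat and u :: complex
  assumes "Re (1 + 3 / 2 * u) > 0"
  shows "CT_abs_convergent (dyson_product a b u) \<and>
    CT (dyson_product a b u) =
      cos (1 / 2 * of_real pi * u) * (Gamma (1 + 3 / 2 * u) / Gamma (1 + 1 / 2 * u) ^ 3) *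
      (\<Prod>i = 0..2::nat.
        pochhammer (1 + 1 / 2 * of_nat i * u) (a + b) /
        (pochhammer (1 + 1 / 2 * of_nat i * u) a * pochhammer (1 + 1 / 2 * of_nat i * u) b))"
proof -
  have u: "Re u > - 2 / 3"
    using assms by simp
  show ?thesis
    unfolding CT_abs_convergent_def CT_def infsum_dyson_product(2)[OF u] ct_pairing_laurent_coeff[OF u]
      dixon_identity[OF u]
    using infsum_dyson_product(1)[OF u] by simp
qed

end
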